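(* Let $\mathcal C$ be a strict monoidal category, $A$ an algebra in $\mathcal C$, and $X\dashv Y$ in $\mathcal C$ (with $b:\underline 1\to YX$, $d:XY\to\underline 1$). For $\psi:XA\to AX$ put $\varphi=YAd\circ Y\psi Y\circ bAY:AY\to YA$. (i) If $(A,X,\psi)$ is a cowreath (with comultiplication $\delta:X\to AXX$ and counit $\epsilon:X\to A$), then $(A,Y,\varphi)$ is a right wreath, with multiplication $m_Y$ and unit $\eta_Y$ given by $$m_Y=YAd^2\circ Y\delta YY\circ bYY:\ YY\to YA,\qquad \eta_Y=Y\epsilon\circ b:\ \underline 1\to YA,$$ where $d^2=d\circ XdY$. The wreath product $YA$ is an algebra in $\mathcal C$ with structure maps $$m_\#=Ym\circ YmA\circ YAAdA\circ YA\psi YA\circ YAXdAYA\circ Y\delta YAYA\circ bYAYA,\qquad \eta_\#=Y\epsilon\circ b.$$ (ii) If $(A,X,\psi)$ is a left wreath (with multiplication $m_X:XX\to AX$ and unit $\eta_X:\underline 1\to AX$), then $(A,Y,\varphi)$ is a left cowreath (i.e. $(Y,\varphi)$ is a coalgebra in ${}_A^\#\mathcal T$), with comultiplication and counit $$\overline\delta=YYAd\circ YYm_XY\circ b^2Y:\ Y\to YYA,\qquad \overline\epsilon=Ad\circ\eta_XY:\ Y\to A,$$ where $b^2=YbX\circ b:\underline 1\to YYXX$.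
   Context: Conventions: $\mathcal C$ is a strict monoidal category with unit object $\underline 1$; the tensor product is written by juxtaposition, and the identity morphism of $X$ is written $X$ (so $fA=f\otimes \mathrm{Id}_A$). $(A,m,\eta)$ is an algebra in $\mathcal C$. $X\dashv Y$ means $b:\underline 1\to YX$, $d:XY\to\underline 1$ satisfy $Yd\circ bY=Y$ and $dX\circ Xb=X$. $\mathcal T_A^\#$: objects $(X,\psi)$, $\psi:XA\to AX$ with $\psi\circ Xm=mX\circ A\psi\circ\psi A$, $\psi\circ X\eta=\eta X$. Morphisms $(X,\psi_X)\to(Y,\psi_Y)$: $f:X\to AY$ in $\mathcal C$ with $mY\circ Af\circ\psi_X=mY\circ A\psi_Y\circ fA$; composition $g\bullet f=mZ\circ Ag\circ f$, identity $\eta X$; tensor product of objects $(XY,\psi_XY\circ X\psi_Y)$, of morphisms $f:X\to AX'$, $g:Y\to AY'$: $mX'Y'\circ A\psi_{X'}Y'\circ fg$; unit $(\underline 1,A)$. ${}_A^\#\mathcal T$ (mirror image): objects $(Y,\varphi)$, $\varphi:AY\to YA$ with $\varphi\circ mY=Ym\circ\varphi A\circ A\varphi$, $\varphi\circ\eta Y=Y\eta$. Morphisms $(X,\varphi_X)\to (Y,\varphi_Y)$: $f:X\to YA$ with $Ym\circ fA\circ\varphi_X=Ym\circ\varphi_YA\circ Af$; composition $g\bullet f=Zm\circ gA\circ f$, identity $X\eta$; tensor product of objects $(XY,X\varphi_Y\circ\varphi_XY)$, of morphisms $f:X\to X'A$, $g:Y\to Y'A$: $X'Y'm\circ X'\varphi_{Y'}A\circ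 fg$; unit $(\underline 1,A)$. A cowreath (resp. left wreath) in $\mathcal C$ is $(A,X,\psi)$ with $(X,\psi)$ a coalgebra (resp. algebra) in $\mathcal T_A^\#$. A right wreath is $(A,Y,\varphi)$ with $(Y,\varphi)$ an algebra in ${}_A^\#\mathcal T$. For a right wreath, the wreath product is the algebra $YA$ in $\mathcal C$ with multiplication $Ym\circ YmA\circ m_YAA\circ Y\varphi A:YAYA\to YA$ and unit $\eta_Y$. *)

theory Defs
  imports Main
begin

text \<open>Composition \<open>g \<cdot> f\<close> is in applicative order and binds weaker than both tensor products.\<close>

record ('o, 'm) monoidal_data =
  Ob :: "'o set"
  Ar :: "'m set"
  Dom :: "'m \<Rightarrow> 'o"
  Cod :: "'m \<Rightarrow> 'o"
  Ident :: "'o \<Rightarrow> 'm"  (\<open>\<iota>\<index> _\<close> [90] 90)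
  Comp :: "'m \<Rightarrow> 'm \<Rightarrow> 'm"  (infixr \<open>\<cdot>\<index>\<close> 70)
  Unit :: 'o  (\<open>\<one>\<index>\<close>)
  TensorOb :: "'o \<Rightarrow> 'o \<Rightarrow> 'o"  (infixr \<open>\<boxtimes>\<index>\<close> 75)
  TensorAr :: "'m \<Rightarrow> 'm \<Rightarrow> 'm"  (infixr \<open>\<otimes>\<index>\<close> 75)

definition Hom :: "('o, 'm) monoidal_data \<Rightarrow> 'o \<Rightarrow> 'o \<Rightarrow> 'm set"
  where "Hom C X Y = {f \<in> Ar C. Dom C f = X \<and> Cod C f = Y}"

locale strict_monoidal_category =
  fixes C :: "('o, 'm) monoidal_data" (structure)
  assumes Dom_in: "f \<in> Ar C \<Longrightarrow> Dom C f \<in> Ob C"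
    and Cod_in: "f \<in> Ar C \<Longrightarrow> Cod C f \<in> Ob C"
    and Ident_in: "X \<in> Ob C \<Longrightarrow> \<iota> X \<in> Hom C X X"
    and Comp_in: "\<lbrakk>f \<in> Hom C X Y; g \<in> Hom C Y Z\<rbrakk> \<Longrightarrow> g \<cdot> f \<in> Hom C X Z"
    and Comp_Ident: "f \<in> Hom C X Y \<Longrightarrow> f \<cdot> \<iota> X = f"
    and Ident_Comp: "f \<in> Hom C X Y \<Longrightarrow> \<iota> Y \<cdot> f = f"
    and Comp_assoc: "\<lbrakk>f \<in> Hom C W X; g \<in> Hom C X Y; h \<in> Hom C Y Z\<rbrakk>
        \<Longrightarrow> (h \<cdot> g) \<cdot> f = h \<cdot> (g \<cdot> f)"
    and Unit_in: "\<one> \<in> Ob C"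
    and TensorOb_in: "\<lbrakk>X \<in> Ob C; Y \<in> Ob C\<rbrakk> \<Longrightarrow> X \<boxtimes> Y \<in> Ob C"
    and TensorAr_in: "\<lbrakk>f \<in> Hom C X X'; g \<in> Hom C Y Y'\<rbrakk>
        \<Longrightarrow> f \<otimes> g \<in> Hom C (X \<boxtimes> Y) (X' \<boxtimes> Y')"
    and Tensor_Ident: "\<lbrakk>X \<in> Ob C; Y \<in> Ob C\<rbrakk> \<Longrightarrow> \<iota> X \<otimes> \<iota> Y = \<iota> (X \<boxtimes> Y)"
    and interchange: "\<lbrakk>f \<in> Hom C X X'; f' \<in> Hom C X' X''; g \<in> Hom C Y Y'; g' \<in> Hom C Y' Y''\<rbrakk>
        \<Longrightarrow> (f' \<cdot> f) \<otimes> (g' \<cdot> g) = (f' \<otimes> g') \<cdot> (f \<otimes> g)"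
    and TensorOb_assoc: "\<lbrakk>X \<in> Ob C; Y \<in> Ob C; Z \<in> Ob C\<rbrakk>
        \<Longrightarrow> (X \<boxtimes> Y) \<boxtimes> Z = X \<boxtimes> (Y \<boxtimes> Z)"
    and TensorOb_Unit: "X \<in> Ob C \<Longrightarrow> X \<boxtimes> \<one> = X"
    and Unit_TensorOb: "X \<in> Ob C \<Longrightarrow> \<one> \<boxtimes> X = X"
    and TensorAr_assoc: "\<lbrakk>f \<in> Ar C; g \<in> Ar C; h \<in> Ar C\<rbrakk>
        \<Longrightarrow> (f \<otimes> g) \<otimes> h = f \<otimes> (g \<otimes> h)"
    and TensorAr_Unit: "f \<in> Ar C \<Longrightarrow> f \<otimes> \<iota> \<one> = f"
    and Unit_TensorAr: "f \<in> Ar C \<Longrightarrow> \<iota> \<one> \<otimes> f = f"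

definition algebra_in :: "('o, 'm) monoidal_data \<Rightarrow> 'o \<Rightarrow> 'm \<Rightarrow> 'm \<Rightarrow> bool"
  where "algebra_in C A m \<eta> \<longleftrightarrow>
      A \<in> Ob C \<and> m \<in> Hom C (A \<boxtimes> A) A \<and> \<eta> \<in> Hom C \<one> A \<and>
      m \<cdot> (m \<otimes> \<iota> A) = m \<cdot> (\<iota> A \<otimes> m) \<and>
      m \<cdot> (\<eta> \<otimes> \<iota> A) = \<iota> A \<and>
      m \<cdot> (\<iota> A \<otimes> \<eta>) = \<iota> A"
  for C (structure)

definition coalgebra_in :: "('o, 'm) monoidal_data \<Rightarrow> 'o \<Rightarrow> 'm \<Rightarrow> 'm \<Rightarrow> bool"
  where "coalgebra_in C X \<delta> \<epsilon> \<longleftrightarrow>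
      X \<in> Ob C \<and> \<delta> \<in> Hom C X (X \<boxtimes> X) \<and> \<epsilon> \<in> Hom C X \<one> \<and>
      (\<delta> \<otimes> \<iota> X) \<cdot> \<delta> = (\<iota> X \<otimes> \<delta>) \<cdot> \<delta> \<and>
      (\<epsilon> \<otimes> \<iota> X) \<cdot> \<delta> = \<iota> X \<and>
      (\<iota> X \<otimes> \<epsilon>) \<cdot> \<delta> = \<iota> X"
  for C (structure)

definition adjunction_in :: "('o, 'm) monoidal_data \<Rightarrow> 'o \<Rightarrow> 'o \<Rightarrow> 'm \<Rightarrow> 'm \<Rightarrow> bool"
  where "adjunction_in C X Y b d \<longleftrightarrow>
      X \<in> Ob C \<and> Y \<in> Ob C \<and> b \<in> Hom C \<one> (Y \<boxtimes> X) \<and> d \<in> Hom C (X \<boxtimes> Y) \<one> \<and>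
      (\<iota> Y \<otimes> d) \<cdot> (b \<otimes> \<iota> Y) = \<iota> Y \<and>
      (d \<otimes> \<iota> X) \<cdot> (\<iota> X \<otimes> b) = \<iota> X"
  for C (structure)


text \<open>
  The categories \<open>\<T>\<^sub>A\<^sup>#\<close> (\<open>TransferR\<close>) and \<open>\<^sub>A\<^sup>#\<T>\<close> (\<open>TransferL\<close>).
  Since one morphism \<open>f\<close> of \<open>C\<close> can underlie morphisms between different objects, an
  arrow is a triple (source, \<open>f\<close>, target).
\<close>

definition TransferR :: "('o, 'm) monoidal_data \<Rightarrow> 'o \<Rightarrow> 'm \<Rightarrow> 'm
    \<Rightarrow> ('o \<times> 'm, ('o \<times> 'm) \<times> 'm \<times> ('o \<times> 'm)) monoidal_data"
  where "TransferR C A m \<eta> =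
    (let obs = {(X, \<psi>). X \<in> Ob C \<and> \<psi> \<in> Hom C (X \<boxtimes> A) (A \<boxtimes> X) \<and>
                 \<psi> \<cdot> (\<iota> X \<otimes> m) = (m \<otimes> \<iota> X) \<cdot> (\<iota> A \<otimes> \<psi>) \<cdot> (\<psi> \<otimes> \<iota> A) \<and>
                 \<psi> \<cdot> (\<iota> X \<otimes> \<eta>) = \<eta> \<otimes> \<iota> X};
         tens = (\<lambda>(X, \<psi>\<^sub>X) (Y, \<psi>\<^sub>Y). (X \<boxtimes> Y, (\<psi>\<^sub>X \<otimes> \<iota> Y) \<cdot> (\<iota> X \<otimes> \<psi>\<^sub>Y)))
     in \<lparr>Ob = obs,
         Ar = {((X, \<psi>\<^sub>X), f, (Y, \<psi>\<^sub>Y)) | X \<psi>\<^sub>X f Y \<psi>\<^sub>Y.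
                 (X, \<psi>\<^sub>X) \<in> obs \<and> (Y, \<psi>\<^sub>Y) \<in> obs \<and> f \<in> Hom C X (A \<boxtimes> Y) \<and>
                 (m \<otimes> \<iota> Y) \<cdot> (\<iota> A \<otimes> f) \<cdot> \<psi>\<^sub>X = (m \<otimes> \<iota> Y) \<cdot> (\<iota> A \<otimes> \<psi>\<^sub>Y) \<cdot> (f \<otimes> \<iota> A)},
         Dom = (\<lambda>(S, f, T). S),
         Cod = (\<lambda>(S, f, T). T),
         Ident = (\<lambda>(X, \<psi>). ((X, \<psi>), \<eta> \<otimes> \<iota> X, (X, \<psi>))),
         Comp = (\<lambda>(_, g, (Z, \<psi>\<^sub>Z)) (S, f, _). (S, (m \<otimes> \<iota> Z) \<cdot> (\<iota> A \<otimes> g) \<cdot> f, (Z, \<psi>\<^sub>Z))),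
         Unit = (\<one>, \<iota> A),
         TensorOb = tens,
         TensorAr = (\<lambda>(S, f, (X', \<psi>\<^sub>X')) (R, g, (Y', \<psi>\<^sub>Y')).
           (tens S R,
            (m \<otimes> \<iota> X' \<otimes> \<iota> Y') \<cdot> (\<iota> A \<otimes> \<psi>\<^sub>X' \<otimes> \<iota> Y') \<cdot> (f \<otimes> g),
            tens (X', \<psi>\<^sub>X') (Y', \<psi>\<^sub>Y')))\<rparr>)"
  for C (structure)

definition TransferL :: "('o, 'm) monoidal_data \<Rightarrow> 'o \<Rightarrow> 'm \<Rightarrow> 'm
    \<Rightarrow> ('o \<times> 'm, ('o \<times> 'm) \<times> 'm \<times> ('o \<times> 'm)) monoidal_data"
  where "TransferL C A m \<eta> =
    (let obs = {(Y, \<phi>). Y \<in> Ob C \<and> \<phi> \<in> Hom C (A \<boxtimes> Y) (Y \<boxtimes> A) \<and>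
                 \<phi> \<cdot> (m \<otimes> \<iota> Y) = (\<iota> Y \<otimes> m) \<cdot> (\<phi> \<otimes> \<iota> A) \<cdot> (\<iota> A \<otimes> \<phi>) \<and>
                 \<phi> \<cdot> (\<eta> \<otimes> \<iota> Y) = \<iota> Y \<otimes> \<eta>};
         tens = (\<lambda>(X, \<phi>\<^sub>X) (Y, \<phi>\<^sub>Y). (X \<boxtimes> Y, (\<iota> X \<otimes> \<phi>\<^sub>Y) \<cdot> (\<phi>\<^sub>X \<otimes> \<iota> Y)))
     in \<lparr>Ob = obs,
         Ar = {((X, \<phi>\<^sub>X), f, (Y, \<phi>\<^sub>Y)) | X \<phi>\<^sub>X f Y \<phi>\<^sub>Y.
                 (X, \<phi>\<^sub>X) \<in> obs \<and> (Y, \<phi>\<^sub>Y) \<in> obs \<and> f \<in> Hom C X (Y \<boxtimes> A) \<and>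
                 (\<iota> Y \<otimes> m) \<cdot> (f \<otimes> \<iota> A) \<cdot> \<phi>\<^sub>X = (\<iota> Y \<otimes> m) \<cdot> (\<phi>\<^sub>Y \<otimes> \<iota> A) \<cdot> (\<iota> A \<otimes> f)},
         Dom = (\<lambda>(S, f, T). S),
         Cod = (\<lambda>(S, f, T). T),
         Ident = (\<lambda>(X, \<phi>). ((X, \<phi>), \<iota> X \<otimes> \<eta>, (X, \<phi>))),
         Comp = (\<lambda>(_, g, (Z, \<phi>\<^sub>Z)) (S, f, _). (S, (\<iota> Z \<otimes> m) \<cdot> (g \<otimes> \<iota> A) \<cdot> f, (Z, \<phi>\<^sub>Z))),
         Unit = (\<one>, \<iota> A),
         TensorOb = tens,
         TensorAr = (\<lambda>(S, f, (X', \<phi>\<^sub>X')) (R, g, (Y', \<phi>\<^sub>Y')).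
           (tens S R,
            (\<iota> X' \<otimes> \<iota> Y' \<otimes> m) \<cdot> (\<iota> X' \<otimes> \<phi>\<^sub>Y' \<otimes> \<iota> A) \<cdot> (f \<otimes> g),
            tens (X', \<phi>\<^sub>X') (Y', \<phi>\<^sub>Y')))\<rparr>)"
  for C (structure)


text \<open>
  In the predicates below the structure morphisms are given by their underlying morphisms
  in \<open>C\<close>, e.g. \<open>\<delta> : X \<rightarrow> A X X\<close> and \<open>\<epsilon> : X \<rightarrow> A\<close> for a cowreath.
\<close>

definition cowreath :: "('o, 'm) monoidal_data \<Rightarrow> 'o \<Rightarrow> 'm \<Rightarrow> 'm \<Rightarrow> 'o \<Rightarrow> 'm \<Rightarrow> 'm \<Rightarrow> 'm \<Rightarrow> bool"
  where "cowreath C A m \<eta> X \<psi> \<delta> \<epsilon> \<longleftrightarrow>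
    (let T = TransferR C A m \<eta>
     in algebra_in C A m \<eta> \<and>
        coalgebra_in T (X, \<psi>) ((X, \<psi>), \<delta>, (X, \<psi>) \<boxtimes>\<^bsub>T\<^esub> (X, \<psi>)) ((X, \<psi>), \<epsilon>, \<one>\<^bsub>T\<^esub>))"

definition left_wreath :: "('o, 'm) monoidal_data \<Rightarrow> 'o \<Rightarrow> 'm \<Rightarrow> 'm \<Rightarrow> 'o \<Rightarrow> 'm \<Rightarrow> 'm \<Rightarrow> 'm \<Rightarrow> bool"
  where "left_wreath C A m \<eta> X \<psi> m\<^sub>X \<eta>\<^sub>X \<longleftrightarrow>
    (let T = TransferR C A m \<eta>
     in algebra_in C A m \<eta> \<and>
        algebra_in T (X, \<psi>) ((X, \<psi>) \<boxtimes>\<^bsub>T\<^esub> (X, \<psi>), m\<^sub>X, (X, \<psi>)) (\<one>\<^bsub>T\<^esub>, \<eta>\<^sub>X, (X, \<psi>)))"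

definition right_wreath :: "('o, 'm) monoidal_data \<Rightarrow> 'o \<Rightarrow> 'm \<Rightarrow> 'm \<Rightarrow> 'o \<Rightarrow> 'm \<Rightarrow> 'm \<Rightarrow> 'm \<Rightarrow> bool"
  where "right_wreath C A m \<eta> Y \<phi> m\<^sub>Y \<eta>\<^sub>Y \<longleftrightarrow>
    (let T = TransferL C A m \<eta>
     in algebra_in C A m \<eta> \<and>
        algebra_in T (Y, \<phi>) ((Y, \<phi>) \<boxtimes>\<^bsub>T\<^esub> (Y, \<phi>), m\<^sub>Y, (Y, \<phi>)) (\<one>\<^bsub>T\<^esub>, \<eta>\<^sub>Y, (Y, \<phi>)))"

definition left_cowreath :: "('o, 'm) monoidal_data \<Rightarrow> 'o \<Rightarrow> 'm \<Rightarrow> 'm \<Rightarrow> 'o \<Rightarrow> 'm \<Rightarrow> 'm \<Rightarrow> 'm \<Rightarrow> bool"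
  where "left_cowreath C A m \<eta> Y \<phi> \<delta> \<epsilon> \<longleftrightarrow>
    (let T = TransferL C A m \<eta>
     in algebra_in C A m \<eta> \<and>
        coalgebra_in T (Y, \<phi>) ((Y, \<phi>), \<delta>, (Y, \<phi>) \<boxtimes>\<^bsub>T\<^esub> (Y, \<phi>)) ((Y, \<phi>), \<epsilon>, \<one>\<^bsub>T\<^esub>))"

text \<open>The wreath product of a right wreath is \<open>Y \<boxtimes> A\<close> with this multiplication and unit \<open>\<eta>\<^sub>Y\<close>.\<close>

definition wreath_product_mult :: "('o, 'm) monoidal_data \<Rightarrow> 'o \<Rightarrow> 'm \<Rightarrow> 'o \<Rightarrow> 'm \<Rightarrow> 'm \<Rightarrow> 'm"
  where "wreath_product_mult C A m Y \<phi> m\<^sub>Y =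
      (\<iota> Y \<otimes> m) \<cdot> (\<iota> Y \<otimes> m \<otimes> \<iota> A) \<cdot> (m\<^sub>Y \<otimes> \<iota> A \<otimes> \<iota> A) \<cdot> (\<iota> Y \<otimes> \<phi> \<otimes> \<iota> A)"
  for C (structure)

end

theory Submission
  imports Defs
begin

text \<open>
  For adjunctions between \<open>P, Q\<close> and between \<open>P', Q'\<close> with counits \<open>d\<close> and \<open>d'\<close>, call \<open>f : PU \<rightarrow> VP'\<close> and \<open>g : UQ' \<rightarrow> QV\<close> mates if
  \<open>dV \<circ> Pg = Vd' \<circ> fQ'\<close>. Every \<open>f\<close> has exactly one mate, and mates are compatible with horizontal
  pasting, with tensor products of adjunctions and with composition with morphisms \<open>U' \<rightarrow> U\<close> and \<open>V \<rightarrow> V'\<close>.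
  The case \<open>U = V = A\<close> turns \<open>\<psi>\<close> into \<open>\<phi>\<close>, and the case \<open>U = \<one>\<close>, \<open>V = A\<close> turns morphisms of
  \<open>\<T>\<^sub>A\<^sup>#\<close> into morphisms of \<open>\<^sub>A\<^sup>#\<T>\<close>. This assignment reverses both composition and tensor
  products, so it exchanges coalgebras and algebras. The structure maps in the theorem are the
  mates of the given ones, and the axioms for them follow from uniqueness of mates.
\<close>

subsection \<open>Diagram calculus in a strict monoidal category\<close>

context strict_monoidal_category
begin

lemma HomD: "f \<in> Hom C X Y \<Longrightarrow> f \<in> Ar C \<and> Dom C f = X \<and> Cod C f = Y"
  by (simp add: Hom_def)

lemma HomI: "f \<in> Ar C \<Longrightarrow> f \<in> Hom C (Dom C f) (Cod C f)"
  by (simp add: Hom_def)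

lemma Ident_typing:
  assumes "X \<in> Ob C"
  shows "\<iota> X \<in> Ar C" "Dom C (\<iota> X) = X" "Cod C (\<iota> X) = X"
  using HomD[OF Ident_in[OF assms]] by simp_all

text \<open>The axioms speak of \<open>Hom\<close>, where the middle object of a composite has to be
  guessed. Phrased through \<open>Ar\<close>, \<open>Dom\<close> and \<open>Cod\<close>, the side
  conditions are facts that rewriting can settle. The primed laws below have their form for the same
  reason.\<close>

lemma Comp_typing:
  assumes "f \<in> Ar C" "g \<in> Ar C" "Dom C g = Cod C f"
  shows "g \<cdot> f \<in> Ar C" "Dom C (g \<cdot> f) = Dom C f" "Cod C (g \<cdot> f) = Cod C g"
  using HomD[OF Comp_in[of f "Dom C f" "Cod C f" g "Cod C g"]] assms by (simp_all add: Hom_def)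

lemma TensorAr_typing:
  assumes "f \<in> Ar C" "g \<in> Ar C"
  shows "f \<otimes> g \<in> Ar C" "Dom C (f \<otimes> g) = Dom C f \<boxtimes> Dom C g" "Cod C (f \<otimes> g) = Cod C f \<boxtimes> Cod C g"
  using HomD[OF TensorAr_in[OF HomI HomI, OF assms]] by simp_all

lemma Comp_Ident': "f \<in> Ar C \<Longrightarrow> Dom C f = X \<Longrightarrow> f \<cdot> \<iota> X = f"
  using Comp_Ident[OF HomI] by blast

lemma Ident_Comp': "f \<in> Ar C \<Longrightarrow> Cod C f = X \<Longrightarrow> \<iota> X \<cdot> f = f"
  using Ident_Comp[OF HomI] by blast

lemma Comp_assoc':
  assumes "f \<in> Ar C" "g \<in> Ar C" "h \<in> Ar C" "Dom C g = Cod C f" "Dom C h = Cod C g"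
  shows "(h \<cdot> g) \<cdot> f = h \<cdot> g \<cdot> f"
  using Comp_assoc[of f "Dom C f" "Cod C f" g "Cod C g" h "Cod C h"] assms by (simp add: Hom_def)

lemma interchange':
  assumes "f \<in> Ar C" "f' \<in> Ar C" "g \<in> Ar C" "g' \<in> Ar C" "Dom C f' = Cod C f" "Dom C g' = Cod C g"
  shows "(f' \<otimes> g') \<cdot> (f \<otimes> g) = (f' \<cdot> f) \<otimes> (g' \<cdot> g)"
  using interchange[of f "Dom C f" "Cod C f" f' "Cod C f'" g "Dom C g" "Cod C g" g' "Cod C g'"] assms
  by (simp add: Hom_def)

definition wh :: "'o \<Rightarrow> 'm \<Rightarrow> 'o \<Rightarrow> 'm"
  where "wh L f R = \<iota> L \<otimes> f \<otimes> \<iota> R"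

lemmas typing_simps = Dom_in Cod_in Ident_typing Comp_typing TensorAr_typing Comp_Ident' Ident_Comp'
  Comp_assoc' Unit_in TensorOb_in TensorOb_assoc TensorOb_Unit Unit_TensorOb

lemma wh_typing:
  assumes "L \<in> Ob C" "R \<in> Ob C" "f \<in> Ar C"
  shows "wh L f R \<in> Ar C" "Dom C (wh L f R) = L \<boxtimes> Dom C f \<boxtimes> R" "Cod C (wh L f R) = L \<boxtimes> Cod C f \<boxtimes> R"
  using assms by (simp_all add: wh_def typing_simps)

lemma wh_Ident: "\<lbrakk>L \<in> Ob C; X \<in> Ob C; R \<in> Ob C\<rbrakk> \<Longrightarrow> wh L (\<iota> X) R = \<iota> (L \<boxtimes> X \<boxtimes> R)"
  by (simp add: wh_def Tensor_Ident typing_simps)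

lemma wh_Unit: "f \<in> Ar C \<Longrightarrow> wh \<one> f \<one> = f"
  by (simp add: wh_def TensorAr_Unit Unit_TensorAr typing_simps)

lemma wh_wh: "\<lbrakk>L \<in> Ob C; L' \<in> Ob C; R \<in> Ob C; R' \<in> Ob C; f \<in> Ar C\<rbrakk>
    \<Longrightarrow> wh L (wh L' f R') R = wh (L \<boxtimes> L') f (R' \<boxtimes> R)"
  by (simp add: wh_def TensorAr_assoc typing_simps flip: Tensor_Ident)

lemma wh_Comp: "\<lbrakk>L \<in> Ob C; R \<in> Ob C; f \<in> Ar C; g \<in> Ar C; Dom C g = Cod C f\<rbrakk>
    \<Longrightarrow> wh L (g \<cdot> f) R = wh L g R \<cdot> wh L f R"
  by (simp add: wh_def interchange' typing_simps)

text \<open>A tensor product of two arrows can be layered in two ways. The rule fixes the one in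
  which the right factor acts first.\<close>

lemma Tensor_wh:
  assumes "f \<in> Ar C" "g \<in> Ar C"
  shows "f \<otimes> g = wh \<one> f (Cod C g) \<cdot> wh (Dom C f) g \<one>"
  using assms by (simp add: wh_def interchange' TensorAr_Unit Unit_TensorAr typing_simps)

text \<open>
  As rewrite rules these turn every expression into a composite of layers \<open>wh L f R\<close>, each with a
  single generator \<open>f\<close>. The layers are unique up to interchange, which is applied by hand
  through \<open>slide\<close>.
\<close>
lemmas diagram_simps = typing_simps wh_typing wh_Ident wh_Unit wh_wh wh_Comp Tensor_wh Hom_def

text \<open>Arrows on disjoint strands commute: by interchange, both sides are the tensor product of
  \<open>f\<close>, the identity of \<open>M\<close> and \<open>g\<close>, whiskered by
  \<open>L\<close> and \<open>R\<close>.\<close>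

lemma slide:
  assumes "f \<in> Ar C" "g \<in> Ar C" "L \<in> Ob C" "M \<in> Ob C" "R \<in> Ob C"
  shows "wh L f (M \<boxtimes> Cod C g \<boxtimes> R) \<cdot> wh (L \<boxtimes> Dom C f \<boxtimes> M) g R
    = wh (L \<boxtimes> Cod C f \<boxtimes> M) g R \<cdot> wh L f (M \<boxtimes> Dom C g \<boxtimes> R)"
proof -
  have "wh L f (M \<boxtimes> Cod C g \<boxtimes> R) \<cdot> wh (L \<boxtimes> Dom C f \<boxtimes> M) g R
     = wh L ((f \<otimes> \<iota> (M \<boxtimes> Cod C g)) \<cdot> (\<iota> (Dom C f) \<otimes> \<iota> M \<otimes> g)) R"
    using assms by (simp add: diagram_simps)
  also have "(f \<otimes> \<iota> (M \<boxtimes> Cod C g)) \<cdot> (\<iota> (Dom C f) \<otimes> \<iota> M \<otimes> g)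
     = (\<iota> (Cod C f) \<otimes> \<iota> M \<otimes> g) \<cdot> (f \<otimes> \<iota> (M \<boxtimes> Dom C g))"
    using assms by (simp add: interchange' typing_simps)
  also have "wh L \<dots> R = wh (L \<boxtimes> Cod C f \<boxtimes> M) g R \<cdot> wh L f (M \<boxtimes> Dom C g \<boxtimes> R)"
    using assms by (simp add: diagram_simps)
  finally show ?thesis .
qed

subsection \<open>Mates\<close>

lemma adjunctionD:
  assumes "adjunction_in C X Y b d"
  shows "X \<in> Ob C" "Y \<in> Ob C" "b \<in> Ar C" "Dom C b = \<one>" "Cod C b = Y \<boxtimes> X"
    "d \<in> Ar C" "Dom C d = X \<boxtimes> Y" "Cod C d = \<one>"
    "(\<iota> Y \<otimes> d) \<cdot> (b \<otimes> \<iota> Y) = \<iota> Y" "(d \<otimes> \<iota> X) \<cdot> (\<iota> X \<otimes> b) = \<iota> X"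
  using assms by (auto simp: adjunction_in_def Hom_def)

text \<open>Half of the bijection between arrows \<open>XW \<rightarrow> V\<close> and
  \<open>W \<rightarrow> YV\<close> given by the adjunction. Sliding \<open>h\<close> past
  \<open>d\<close> leaves the triangle identity for \<open>X\<close>.\<close>

lemma transpose_untranspose:
  assumes "adjunction_in C X Y b d" "W \<in> Ob C" "V \<in> Ob C" "h \<in> Hom C (X \<boxtimes> W) V"
  shows "(d \<otimes> \<iota> V) \<cdot> (\<iota> X \<otimes> ((\<iota> Y \<otimes> h) \<cdot> (b \<otimes> \<iota> W))) = h"
proof -
  note [simp] = adjunctionD(1-8)[OF assms(1)] assms(2,3) HomD[OF assms(4)]
  have s: "wh \<one> d V \<cdot> wh (X \<boxtimes> Y) h \<one> = h \<cdot> wh \<one> d (X \<boxtimes> W)"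
    using slide[of d h \<one> \<one> \<one>] by (simp add: diagram_simps)
  have "(d \<otimes> \<iota> V) \<cdot> (\<iota> X \<otimes> ((\<iota> Y \<otimes> h) \<cdot> (b \<otimes> \<iota> W)))
      = (wh \<one> d V \<cdot> wh (X \<boxtimes> Y) h \<one>) \<cdot> wh X b W"
    by (simp add: diagram_simps)
  also have "\<dots> = h \<cdot> wh \<one> ((d \<otimes> \<iota> X) \<cdot> (\<iota> X \<otimes> b)) W"
    unfolding s by (simp add: diagram_simps)
  finally show ?thesis
    unfolding adjunctionD(10)[OF assms(1)] by (simp add: diagram_simps)
qed

text \<open>The other half: sliding \<open>g\<close> past \<open>b\<close> leaves the triangle
  identity for \<open>Y\<close>.\<close>

lemma untranspose_transpose:
  assumes "adjunction_in C X Y b d" "W \<in> Ob C" "V \<in> Ob C" "g \<in> Hom C W (Y \<boxtimes> V)"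
  shows "(\<iota> Y \<otimes> ((d \<otimes> \<iota> V) \<cdot> (\<iota> X \<otimes> g))) \<cdot> (b \<otimes> \<iota> W) = g"
proof -
  note [simp] = adjunctionD(1-8)[OF assms(1)] assms(2,3) HomD[OF assms(4)]
  have s: "wh (Y \<boxtimes> X) g \<one> \<cdot> wh \<one> b W = wh \<one> b (Y \<boxtimes> V) \<cdot> g"
    using slide[of b g \<one> \<one> \<one>] by (simp add: diagram_simps)
  have "(\<iota> Y \<otimes> ((d \<otimes> \<iota> V) \<cdot> (\<iota> X \<otimes> g))) \<cdot> (b \<otimes> \<iota> W)
      = wh Y d V \<cdot> wh (Y \<boxtimes> X) g \<one> \<cdot> wh \<one> b W"
    by (simp add: diagram_simps)
  also have "\<dots> = wh \<one> ((\<iota> Y \<otimes> d) \<cdot> (b \<otimes> \<iota> Y)) V \<cdot> g"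
    unfolding s by (simp add: diagram_simps)
  finally show ?thesis
    unfolding adjunctionD(9)[OF assms(1)] by (simp add: diagram_simps)
qed

text \<open>A relation that mentions counits only, so that closure under pasting can be checked
  without the units. These enter only for existence and uniqueness.\<close>

definition mate :: "'o \<Rightarrow> 'o \<Rightarrow> 'm \<Rightarrow> 'o \<Rightarrow> 'o \<Rightarrow> 'm \<Rightarrow> 'o \<Rightarrow> 'o \<Rightarrow> 'm \<Rightarrow> 'm \<Rightarrow> bool" where
  "mate P Q d P' Q' d' U V f g \<longleftrightarrow> f \<in> Hom C (P \<boxtimes> U) (V \<boxtimes> P') \<and> g \<in> Hom C (U \<boxtimes> Q') (Q \<boxtimes> V) \<and>
    (d \<otimes> \<iota> V) \<cdot> (\<iota> P \<otimes> g) = (\<iota> V \<otimes> d') \<cdot> (f \<otimes> \<iota> Q')"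

text \<open>The unit is hidden because the mate relation sees only counits. That some unit exists is
  what uniqueness of mates rests on.\<close>

definition dual_pair :: "'o \<Rightarrow> 'o \<Rightarrow> 'm \<Rightarrow> bool"
  where "dual_pair X Y d \<longleftrightarrow> (\<exists>b. adjunction_in C X Y b d)"

lemma dual_pairD:
  assumes "dual_pair X Y d"
  shows "X \<in> Ob C" "Y \<in> Ob C" "d \<in> Ar C" "Dom C d = X \<boxtimes> Y" "Cod C d = \<one>"
proof -
  obtain b where "adjunction_in C X Y b d" using assms dual_pair_def by blast
  from adjunctionD[OF this] show "X \<in> Ob C" "Y \<in> Ob C" "d \<in> Ar C" "Dom C d = X \<boxtimes> Y" "Cod C d = \<one>"
    by simp_all
qed

lemma mateD:
  assumes "mate P Q d P' Q' d' U V f g"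
  shows "f \<in> Ar C" "Dom C f = P \<boxtimes> U" "Cod C f = V \<boxtimes> P'"
    "g \<in> Ar C" "Dom C g = U \<boxtimes> Q'" "Cod C g = Q \<boxtimes> V"
    "(d \<otimes> \<iota> V) \<cdot> (\<iota> P \<otimes> g) = (\<iota> V \<otimes> d') \<cdot> (f \<otimes> \<iota> Q')"
  using assms by (auto simp: mate_def Hom_def)

text \<open>Both mates have the same transpose, since it is expressed through \<open>f\<close>, and
  \<open>untranspose_transpose\<close> recovers a mate from its transpose.\<close>

lemma mate_unique:
  assumes "mate P Q d P' Q' d' U V f g" "mate P Q d P' Q' d' U V f g'"
    "dual_pair P Q d" "U \<in> Ob C" "V \<in> Ob C" "Q' \<in> Ob C"
  shows "g = g'"
proof -
  obtain b where b: "adjunction_in C P Q b d" using assms(3) dual_pair_def by blast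
  have "U \<boxtimes> Q' \<in> Ob C" using assms by (simp add: typing_simps)
  then show ?thesis
    using untranspose_transpose[OF b, of "U \<boxtimes> Q'" V g] untranspose_transpose[OF b, of "U \<boxtimes> Q'" V g']
      assms(1,2,5) unfolding mate_def by metis
qed

text \<open>The witness is the right-hand side of the mate equation carried back along the
  adjunction. The map \<open>\<phi>\<close> and all structure maps of the theorem on
  \<open>Y\<close> are instances of this formula.\<close>

lemma mate_exists:
  assumes "adjunction_in C P Q b d" "dual_pair P' Q' d'" "U \<in> Ob C" "V \<in> Ob C"
    "f \<in> Hom C (P \<boxtimes> U) (V \<boxtimes> P')"
  shows "mate P Q d P' Q' d' U V f ((\<iota> Q \<otimes> \<iota> V \<otimes> d') \<cdot> (\<iota> Q \<otimes> f \<otimes> \<iota> Q') \<cdot> (b \<otimes> \<iota> U \<otimes> \<iota> Q'))"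
proof -
  note [simp] = adjunctionD(1-8)[OF assms(1)] dual_pairD[OF assms(2)] assms(3,4) HomD[OF assms(5)]
  let ?h = "(\<iota> V \<otimes> d') \<cdot> (f \<otimes> \<iota> Q')"
  have "(\<iota> Q \<otimes> \<iota> V \<otimes> d') \<cdot> (\<iota> Q \<otimes> f \<otimes> \<iota> Q') \<cdot> (b \<otimes> \<iota> U \<otimes> \<iota> Q')
      = (\<iota> Q \<otimes> ?h) \<cdot> (b \<otimes> \<iota> (U \<boxtimes> Q'))"
    by (simp add: diagram_simps)
  then show ?thesis
    using transpose_untranspose[OF assms(1), of "U \<boxtimes> Q'" V ?h]
    unfolding mate_def by (simp add: diagram_simps)
qed

lemma mate_Ident:
  assumes "dual_pair P Q d"
  shows "mate P Q d P Q d \<one> \<one> (\<iota> P) (\<iota> Q)"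
  using dual_pairD[OF assms] by (simp add: mate_def diagram_simps)

lemma mate_pre:
  assumes "mate P Q d P' Q' d' U V f g" "dual_pair P Q d" "dual_pair P' Q' d'"
    "U \<in> Ob C" "V \<in> Ob C" "u \<in> Hom C U' U"
  shows "mate P Q d P' Q' d' U' V (f \<cdot> (\<iota> P \<otimes> u)) (g \<cdot> (u \<otimes> \<iota> Q'))"
proof -
  have [simp]: "U' \<in> Ob C" using Dom_in[of u] HomD[OF assms(6)] by simp
  note [simp] = mateD(1-6)[OF assms(1)] dual_pairD[OF assms(2)] dual_pairD[OF assms(3)] assms(4,5)
    HomD[OF assms(6)]
  have "(d \<otimes> \<iota> V) \<cdot> (\<iota> P \<otimes> (g \<cdot> (u \<otimes> \<iota> Q'))) = ((d \<otimes> \<iota> V) \<cdot> (\<iota> P \<otimes> g)) \<cdot> wh P u Q'"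
    by (simp add: diagram_simps)
  also have "\<dots> = (\<iota> V \<otimes> d') \<cdot> ((f \<cdot> (\<iota> P \<otimes> u)) \<otimes> \<iota> Q')"
    unfolding mateD(7)[OF assms(1)] by (simp add: diagram_simps)
  finally show ?thesis
    unfolding mate_def by (simp add: diagram_simps)
qed

lemma mate_post:
  assumes "mate P Q d P' Q' d' U V f g" "dual_pair P Q d" "dual_pair P' Q' d'"
    "U \<in> Ob C" "V \<in> Ob C" "v \<in> Hom C V V'"
  shows "mate P Q d P' Q' d' U V' ((v \<otimes> \<iota> P') \<cdot> f) ((\<iota> Q \<otimes> v) \<cdot> g)"
proof -
  have [simp]: "V' \<in> Ob C" using Cod_in[of v] HomD[OF assms(6)] by simp
  note [simp] = mateD(1-6)[OF assms(1)] dual_pairD[OF assms(2)] dual_pairD[OF assms(3)] assms(4,5)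
    HomD[OF assms(6)]
  have s: "wh \<one> d V' \<cdot> wh (P \<boxtimes> Q) v \<one> = v \<cdot> wh \<one> d V"
    using slide[of d v \<one> \<one> \<one>] by (simp add: diagram_simps)
  have t: "v \<cdot> wh V d' \<one> = wh V' d' \<one> \<cdot> wh \<one> v (P' \<boxtimes> Q')"
    using slide[of v d' \<one> \<one> \<one>] by (simp add: diagram_simps)
  have "(d \<otimes> \<iota> V') \<cdot> (\<iota> P \<otimes> ((\<iota> Q \<otimes> v) \<cdot> g)) = (wh \<one> d V' \<cdot> wh (P \<boxtimes> Q) v \<one>) \<cdot> wh P g \<one>"
    by (simp add: diagram_simps)
  also have "\<dots> = v \<cdot> ((d \<otimes> \<iota> V) \<cdot> (\<iota> P \<otimes> g))"
    unfolding s by (simp add: diagram_simps)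
  also have "\<dots> = (v \<cdot> wh V d' \<one>) \<cdot> (f \<otimes> \<iota> Q')"
    unfolding mateD(7)[OF assms(1)] by (simp add: diagram_simps)
  also have "\<dots> = (\<iota> V' \<otimes> d') \<cdot> (((v \<otimes> \<iota> P') \<cdot> f) \<otimes> \<iota> Q')"
    unfolding t by (simp add: diagram_simps)
  finally show ?thesis
    unfolding mate_def by (simp add: diagram_simps)
qed

text \<open>Horizontal pasting. At \<open>d\<close> the first mate equation trades \<open>g\<close>
  for \<open>f\<close>; once \<open>f\<close> has slid past \<open>g'\<close>, the second one trades
  \<open>g'\<close> for \<open>f'\<close> at \<open>d'\<close>. The order of the squares is reversed
  on the right adjoints.\<close>

lemma mate_Comp:
  assumes "mate P Q d P' Q' d' U V f g" "mate P' Q' d' P'' Q'' d'' U' V' f' g'"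
    "dual_pair P Q d" "dual_pair P' Q' d'" "dual_pair P'' Q'' d''"
    "U \<in> Ob C" "V \<in> Ob C" "U' \<in> Ob C" "V' \<in> Ob C"
  shows "mate P Q d P'' Q'' d'' (U \<boxtimes> U') (V \<boxtimes> V')
    ((\<iota> V \<otimes> f') \<cdot> (f \<otimes> \<iota> U')) ((g \<otimes> \<iota> V') \<cdot> (\<iota> U \<otimes> g'))"
proof -
  note [simp] = mateD(1-6)[OF assms(1)] mateD(1-6)[OF assms(2)] dual_pairD[OF assms(3)]
    dual_pairD[OF assms(4)] dual_pairD[OF assms(5)] assms(6-9)
  have s: "wh \<one> f (Q' \<boxtimes> V') \<cdot> wh (P \<boxtimes> U) g' \<one> = wh (V \<boxtimes> P') g' \<one> \<cdot> wh \<one> f (U' \<boxtimes> Q'')"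
    using slide[of f g' \<one> \<one> \<one>] by (simp add: diagram_simps)
  have "(d \<otimes> \<iota> (V \<boxtimes> V')) \<cdot> (\<iota> P \<otimes> ((g \<otimes> \<iota> V') \<cdot> (\<iota> U \<otimes> g')))
      = wh \<one> ((d \<otimes> \<iota> V) \<cdot> (\<iota> P \<otimes> g)) V' \<cdot> wh (P \<boxtimes> U) g' \<one>"
    by (simp add: diagram_simps)
  also have "\<dots> = wh V d' V' \<cdot> wh \<one> f (Q' \<boxtimes> V') \<cdot> wh (P \<boxtimes> U) g' \<one>"
    unfolding mateD(7)[OF assms(1)] by (simp add: diagram_simps)
  also have "\<dots> = wh V ((d' \<otimes> \<iota> V') \<cdot> (\<iota> P' \<otimes> g')) \<one> \<cdot> wh \<one> f (U' \<boxtimes> Q'')"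
    unfolding s by (simp add: diagram_simps)
  also have "\<dots> = (\<iota> (V \<boxtimes> V') \<otimes> d'') \<cdot> (((\<iota> V \<otimes> f') \<cdot> (f \<otimes> \<iota> U')) \<otimes> \<iota> Q'')"
    unfolding mateD(7)[OF assms(2)] by (simp add: diagram_simps)
  finally show ?thesis
    unfolding mate_def by (simp add: diagram_simps)
qed

section \<open>Tensor products of adjunctions\<close>

definition counit_comp :: "'o \<Rightarrow> 'o \<Rightarrow> 'm \<Rightarrow> 'm \<Rightarrow> 'm"
  where "counit_comp R S e d = e \<cdot> (\<iota> R \<otimes> d \<otimes> \<iota> S)"

text \<open>The squares share the strand \<open>V\<close>, which has crossed \<open>P\<close> and is
  about to cross \<open>R\<close>. The right adjoints appear in the opposite order because counits
  nest: the inner pair \<open>P\<close>, \<open>Q\<close> is cancelled before \<open>R\<close>,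
  \<open>S\<close>.\<close>

lemma mate_Tensor:
  assumes "mate P Q d P' Q' d' U V f g" "mate R S e R' S' e' V W h k"
    "dual_pair P Q d" "dual_pair P' Q' d'" "dual_pair R S e" "dual_pair R' S' e'"
    "U \<in> Ob C" "V \<in> Ob C" "W \<in> Ob C"
  shows "mate (R \<boxtimes> P) (Q \<boxtimes> S) (counit_comp R S e d) (R' \<boxtimes> P') (Q' \<boxtimes> S') (counit_comp R' S' e' d') U W
    ((h \<otimes> \<iota> P') \<cdot> (\<iota> R \<otimes> f)) ((\<iota> Q \<otimes> k) \<cdot> (g \<otimes> \<iota> S'))"
proof -
  note [simp] = mateD(1-6)[OF assms(1)] mateD(1-6)[OF assms(2)] dual_pairD[OF assms(3)]
    dual_pairD[OF assms(4)] dual_pairD[OF assms(5)] dual_pairD[OF assms(6)] assms(7-9)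
  have s: "wh R d (S \<boxtimes> W) \<cdot> wh (R \<boxtimes> P \<boxtimes> Q) k \<one> = wh R k \<one> \<cdot> wh R d (V \<boxtimes> S')"
    using slide[of d k R \<one> \<one>] by (simp add: diagram_simps)
  have t: "wh \<one> h S' \<cdot> wh (R \<boxtimes> V) d' S' = wh (W \<boxtimes> R') d' S' \<cdot> wh \<one> h (P' \<boxtimes> Q' \<boxtimes> S')"
    using slide[of h d' \<one> \<one> S'] by (simp add: diagram_simps)
  have "(counit_comp R S e d \<otimes> \<iota> W) \<cdot> (\<iota> (R \<boxtimes> P) \<otimes> ((\<iota> Q \<otimes> k) \<cdot> (g \<otimes> \<iota> S')))
      = wh \<one> e W \<cdot> (wh R d (S \<boxtimes> W) \<cdot> wh (R \<boxtimes> P \<boxtimes> Q) k \<one>) \<cdot> wh (R \<boxtimes> P) g S'"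
    by (simp add: diagram_simps counit_comp_def)
  also have "\<dots> = ((e \<otimes> \<iota> W) \<cdot> (\<iota> R \<otimes> k)) \<cdot> wh R ((d \<otimes> \<iota> V) \<cdot> (\<iota> P \<otimes> g)) S'"
    unfolding s by (simp add: diagram_simps)
  also have "\<dots> = wh W e' \<one> \<cdot> (wh \<one> h S' \<cdot> wh (R \<boxtimes> V) d' S') \<cdot> wh R f (Q' \<boxtimes> S')"
    unfolding mateD(7)[OF assms(1)] mateD(7)[OF assms(2)] by (simp add: diagram_simps)
  also have "\<dots> = (\<iota> W \<otimes> counit_comp R' S' e' d') \<cdot> (((h \<otimes> \<iota> P') \<cdot> (\<iota> R \<otimes> f)) \<otimes> \<iota> (Q' \<boxtimes> S'))"
    unfolding t by (simp add: diagram_simps counit_comp_def)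
  finally show ?thesis
    unfolding mate_def by (simp add: diagram_simps counit_comp_def)
qed

text \<open>After the inner counit has slid past the inner unit, each triangle identity splits into
  the corresponding ones of the two factors. For two copies of one adjunction this yields
  \<open>b^2\<close> and \<open>d^2\<close>.\<close>

lemma adjunction_comp:
  assumes "adjunction_in C P Q b d" "adjunction_in C R S c e"
  shows "adjunction_in C (R \<boxtimes> P) (Q \<boxtimes> S) ((\<iota> Q \<otimes> c \<otimes> \<iota> P) \<cdot> b) (counit_comp R S e d)"
proof -
  note [simp] = adjunctionD(1-8)[OF assms(1)] adjunctionD(1-8)[OF assms(2)]
  have s: "wh (Q \<boxtimes> S \<boxtimes> R) d S \<cdot> wh Q c (P \<boxtimes> Q \<boxtimes> S) = wh Q c S \<cdot> wh Q d S"
    using slide[of c d Q \<one> S] by (simp add: diagram_simps)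
  have "(\<iota> (Q \<boxtimes> S) \<otimes> counit_comp R S e d) \<cdot> (((\<iota> Q \<otimes> c \<otimes> \<iota> P) \<cdot> b) \<otimes> \<iota> (Q \<boxtimes> S))
      = wh (Q \<boxtimes> S) e \<one> \<cdot> (wh (Q \<boxtimes> S \<boxtimes> R) d S \<cdot> wh Q c (P \<boxtimes> Q \<boxtimes> S)) \<cdot> wh \<one> b (Q \<boxtimes> S)"
    by (simp add: diagram_simps counit_comp_def)
  also have "\<dots> = wh Q ((\<iota> S \<otimes> e) \<cdot> (c \<otimes> \<iota> S)) \<one> \<cdot> wh \<one> ((\<iota> Q \<otimes> d) \<cdot> (b \<otimes> \<iota> Q)) S"
    unfolding s by (simp add: diagram_simps)
  also have "\<dots> = \<iota> (Q \<boxtimes> S)"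
    unfolding adjunctionD(9)[OF assms(1)] adjunctionD(9)[OF assms(2)] by (simp add: diagram_simps)
  finally have 1: "(\<iota> (Q \<boxtimes> S) \<otimes> counit_comp R S e d) \<cdot> (((\<iota> Q \<otimes> c \<otimes> \<iota> P) \<cdot> b) \<otimes> \<iota> (Q \<boxtimes> S)) = \<iota> (Q \<boxtimes> S)" .
  have "(counit_comp R S e d \<otimes> \<iota> (R \<boxtimes> P)) \<cdot> (\<iota> (R \<boxtimes> P) \<otimes> ((\<iota> Q \<otimes> c \<otimes> \<iota> P) \<cdot> b))
      = wh \<one> e (R \<boxtimes> P) \<cdot> (wh R d (S \<boxtimes> R \<boxtimes> P) \<cdot> wh (R \<boxtimes> P \<boxtimes> Q) c P) \<cdot> wh (R \<boxtimes> P) b \<one>"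
    by (simp add: diagram_simps counit_comp_def)
  also have "wh R d (S \<boxtimes> R \<boxtimes> P) \<cdot> wh (R \<boxtimes> P \<boxtimes> Q) c P = wh R c P \<cdot> wh R d P"
    using slide[of d c R \<one> P] by (simp add: diagram_simps)
  also have "wh \<one> e (R \<boxtimes> P) \<cdot> (wh R c P \<cdot> wh R d P) \<cdot> wh (R \<boxtimes> P) b \<one>
     = wh \<one> ((e \<otimes> \<iota> R) \<cdot> (\<iota> R \<otimes> c)) P \<cdot> wh R ((d \<otimes> \<iota> P) \<cdot> (\<iota> P \<otimes> b)) \<one>"
    by (simp add: diagram_simps)
  also have "\<dots> = \<iota> (R \<boxtimes> P)"
    unfolding adjunctionD(10)[OF assms(1)] adjunctionD(10)[OF assms(2)] by (simp add: diagram_simps)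
  finally show ?thesis
    using 1 unfolding adjunction_in_def by (simp add: diagram_simps counit_comp_def)
qed

lemma adjunction_Unit: "adjunction_in C \<one> \<one> (\<iota> \<one>) (\<iota> \<one>)"
  by (simp add: adjunction_in_def diagram_simps)

lemma dual_pair_comp: "dual_pair P Q d \<Longrightarrow> dual_pair R S e \<Longrightarrow> dual_pair (R \<boxtimes> P) (Q \<boxtimes> S) (counit_comp R S e d)"
  unfolding dual_pair_def using adjunction_comp by blast

text \<open>Associativity axioms bracket a triple tensor product in two ways, while uniqueness of
  mates compares only arrows taken over literally the same counits.\<close>

lemma counit_comp_assoc:
  assumes "dual_pair P Q d" "dual_pair R S e" "dual_pair T U f"
  shows "counit_comp T U f (counit_comp R S e d) = counit_comp (T \<boxtimes> R) (S \<boxtimes> U) (counit_comp T U f e) d"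
  using dual_pairD[OF assms(1)] dual_pairD[OF assms(2)] dual_pairD[OF assms(3)]
  by (simp add: counit_comp_def diagram_simps)

lemma counit_comp_Unit:
  assumes "dual_pair P Q d"
  shows "counit_comp \<one> \<one> (\<iota> \<one>) d = d" "counit_comp P Q d (\<iota> \<one>) = d"
  using dual_pairD[OF assms] by (simp_all add: counit_comp_def diagram_simps)

end

subsection \<open>Duality between the transfer categories\<close>

lemma TransferR_Ob:
  fixes C (structure)
  shows "(X, \<psi>) \<in> Ob (TransferR C A m \<eta>) \<longleftrightarrow> X \<in> Ob C \<and> \<psi> \<in> Hom C (X \<boxtimes> A) (A \<boxtimes> X) \<and>
    \<psi> \<cdot> (\<iota> X \<otimes> m) = (m \<otimes> \<iota> X) \<cdot> (\<iota> A \<otimes> \<psi>) \<cdot> (\<psi> \<otimes> \<iota> A) \<and>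
    \<psi> \<cdot> (\<iota> X \<otimes> \<eta>) = \<eta> \<otimes> \<iota> X"
  by (simp add: TransferR_def Let_def)

lemma TransferR_Ar:
  fixes C (structure)
  shows "((X, \<psi>\<^sub>X), f, (Y, \<psi>\<^sub>Y)) \<in> Ar (TransferR C A m \<eta>) \<longleftrightarrow>
    (X, \<psi>\<^sub>X) \<in> Ob (TransferR C A m \<eta>) \<and> (Y, \<psi>\<^sub>Y) \<in> Ob (TransferR C A m \<eta>) \<and> f \<in> Hom C X (A \<boxtimes> Y) \<and>
    (m \<otimes> \<iota> Y) \<cdot> (\<iota> A \<otimes> f) \<cdot> \<psi>\<^sub>X = (m \<otimes> \<iota> Y) \<cdot> (\<iota> A \<otimes> \<psi>\<^sub>Y) \<cdot> (f \<otimes> \<iota> A)"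
  by (simp add: TransferR_def Let_def)

lemma TransferR_sel:
  fixes C (structure)
  shows "Dom (TransferR C A m \<eta>) (S, f, T) = S" "Cod (TransferR C A m \<eta>) (S, f, T) = T"
    "Ident (TransferR C A m \<eta>) (X, \<psi>) = ((X, \<psi>), \<eta> \<otimes> \<iota> X, (X, \<psi>))"
    "Comp (TransferR C A m \<eta>) (T', g, (Z, \<psi>\<^sub>Z)) (S, f, T) = (S, (m \<otimes> \<iota> Z) \<cdot> (\<iota> A \<otimes> g) \<cdot> f, (Z, \<psi>\<^sub>Z))"
    "Unit (TransferR C A m \<eta>) = (\<one>, \<iota> A)"
    "TensorOb (TransferR C A m \<eta>) (X, \<psi>\<^sub>X) (Y, \<psi>\<^sub>Y) = (X \<boxtimes> Y, (\<psi>\<^sub>X \<otimes> \<iota> Y) \<cdot> (\<iota> X \<otimes> \<psi>\<^sub>Y))"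
    "TensorAr (TransferR C A m \<eta>) (S, f, (X', \<psi>\<^sub>X')) (R, h, (Y', \<psi>\<^sub>Y')) =
      (TensorOb (TransferR C A m \<eta>) S R,
       (m \<otimes> \<iota> X' \<otimes> \<iota> Y') \<cdot> (\<iota> A \<otimes> \<psi>\<^sub>X' \<otimes> \<iota> Y') \<cdot> (f \<otimes> h),
       TensorOb (TransferR C A m \<eta>) (X', \<psi>\<^sub>X') (Y', \<psi>\<^sub>Y'))"
  by (simp_all add: TransferR_def Let_def)

lemma TransferL_Ob:
  fixes C (structure)
  shows "(Y, \<phi>) \<in> Ob (TransferL C A m \<eta>) \<longleftrightarrow> Y \<in> Ob C \<and> \<phi> \<in> Hom C (A \<boxtimes> Y) (Y \<boxtimes> A) \<and>
    \<phi> \<cdot> (m \<otimes> \<iota> Y) = (\<iota> Y \<otimes> m) \<cdot> (\<phi> \<otimes> \<iota> A) \<cdot> (\<iota> A \<otimes> \<phi>) \<and>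
    \<phi> \<cdot> (\<eta> \<otimes> \<iota> Y) = \<iota> Y \<otimes> \<eta>"
  by (simp add: TransferL_def Let_def)

lemma TransferL_Ar:
  fixes C (structure)
  shows "((X, \<phi>\<^sub>X), f, (Y, \<phi>\<^sub>Y)) \<in> Ar (TransferL C A m \<eta>) \<longleftrightarrow>
    (X, \<phi>\<^sub>X) \<in> Ob (TransferL C A m \<eta>) \<and> (Y, \<phi>\<^sub>Y) \<in> Ob (TransferL C A m \<eta>) \<and> f \<in> Hom C X (Y \<boxtimes> A) \<and>
    (\<iota> Y \<otimes> m) \<cdot> (f \<otimes> \<iota> A) \<cdot> \<phi>\<^sub>X = (\<iota> Y \<otimes> m) \<cdot> (\<phi>\<^sub>Y \<otimes> \<iota> A) \<cdot> (\<iota> A \<otimes> f)"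
  by (simp add: TransferL_def Let_def)

lemma TransferL_sel:
  fixes C (structure)
  shows "Dom (TransferL C A m \<eta>) (S, f, T) = S" "Cod (TransferL C A m \<eta>) (S, f, T) = T"
    "Ident (TransferL C A m \<eta>) (Y, \<phi>) = ((Y, \<phi>), \<iota> Y \<otimes> \<eta>, (Y, \<phi>))"
    "Comp (TransferL C A m \<eta>) (T', g, (Z, \<phi>\<^sub>Z)) (S, f, T) = (S, (\<iota> Z \<otimes> m) \<cdot> (g \<otimes> \<iota> A) \<cdot> f, (Z, \<phi>\<^sub>Z))"
    "Unit (TransferL C A m \<eta>) = (\<one>, \<iota> A)"
    "TensorOb (TransferL C A m \<eta>) (X, \<phi>\<^sub>X) (Y, \<phi>\<^sub>Y) = (X \<boxtimes> Y, (\<iota> X \<otimes> \<phi>\<^sub>Y) \<cdot> (\<phi>\<^sub>X \<otimes> \<iota> Y))"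
    "TensorAr (TransferL C A m \<eta>) (S, f, (X', \<phi>\<^sub>X')) (R, h, (Y', \<phi>\<^sub>Y')) =
      (TensorOb (TransferL C A m \<eta>) S R,
       (\<iota> X' \<otimes> \<iota> Y' \<otimes> m) \<cdot> (\<iota> X' \<otimes> \<phi>\<^sub>Y' \<otimes> \<iota> A) \<cdot> (f \<otimes> h),
       TensorOb (TransferL C A m \<eta>) (X', \<phi>\<^sub>X') (Y', \<phi>\<^sub>Y'))"
  by (simp_all add: TransferL_def Let_def)

section \<open>Mates of objects and arrows of the transfer categories\<close>

locale algebra_in_category = strict_monoidal_category C for C :: "('o, 'm) monoidal_data" (structure) +
  fixes A m \<eta>
  assumes alg: "algebra_in C A m \<eta>"
begin

lemma A_typing [simp]:
  "A \<in> Ob C" "m \<in> Ar C" "Dom C m = A \<boxtimes> A" "Cod C m = A" "\<eta> \<in> Ar C" "Dom C \<eta> = \<one>" "Cod C \<eta> = A"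
  using alg by (auto simp: algebra_in_def Hom_def)

abbreviation "TR \<equiv> TransferR C A m \<eta>"
abbreviation "TL \<equiv> TransferL C A m \<eta>"

text \<open>A duality functor would require a chosen dual of every object. A relation with explicit
  counit asks for duals only of the objects that occur.\<close>

definition mate_ob :: "'m \<Rightarrow> 'o \<times> 'm \<Rightarrow> 'o \<times> 'm \<Rightarrow> bool" where
  "mate_ob d x y \<longleftrightarrow> dual_pair (fst x) (fst y) d \<and>
    mate (fst x) (fst y) d (fst x) (fst y) d A A (snd x) (snd y)"

text \<open>Duality reverses arrows: the second argument runs from the dual of the codomain to the dual of the domain.\<close>
definition mate_ar :: "'m \<Rightarrow> 'm \<Rightarrow> ('o \<times> 'm) \<times> 'm \<times> ('o \<times> 'm) \<Rightarrow> ('o \<times> 'm) \<times> 'm \<times> ('o \<times> 'm) \<Rightarrow> bool" where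
  "mate_ar d d' F G \<longleftrightarrow> (case (F, G) of ((x, f, x'), (y', g, y)) \<Rightarrow>
    mate_ob d x y \<and> mate_ob d' x' y' \<and> mate (fst x) (fst y) d (fst x') (fst y') d' \<one> A f g)"

lemma mate_ob_iff: "mate_ob d (X, \<psi>) (Y, \<phi>) \<longleftrightarrow> dual_pair X Y d \<and> mate X Y d X Y d A A \<psi> \<phi>"
  by (simp add: mate_ob_def)

lemma mate_ar_iff: "mate_ar d d' ((X, \<psi>), f, (X', \<psi>')) ((Y', \<phi>'), g, (Y, \<phi>)) \<longleftrightarrow>
    mate_ob d (X, \<psi>) (Y, \<phi>) \<and> mate_ob d' (X', \<psi>') (Y', \<phi>') \<and> mate X Y d X' Y' d' \<one> A f g"
  by (simp add: mate_ar_def)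

text \<open>The two sides of each axiom for \<open>\<phi>\<close> are mates of the two sides of the
  corresponding axiom for \<open>\<psi>\<close>, so uniqueness of mates carries the axiom over. The
  multiplicative one pastes \<open>\<psi>\<close> with itself and follows with
  \<open>m\<close>.\<close>

lemma mate_ob_Ob:
  assumes "mate_ob d x y" "x \<in> Ob TR"
  shows "y \<in> Ob TL"
proof -
  obtain X \<psi> Y \<phi> where [simp]: "x = (X, \<psi>)" "y = (Y, \<phi>)" by (cases x, cases y)
  have dp: "dual_pair X Y d" and mt: "mate X Y d X Y d A A \<psi> \<phi>"
    using assms(1) by (simp_all add: mate_ob_iff)
  note [simp] = dual_pairD[OF dp] mateD(1-6)[OF mt]
  have \<psi>: "\<psi> \<cdot> (\<iota> X \<otimes> m) = (m \<otimes> \<iota> X) \<cdot> (\<iota> A \<otimes> \<psi>) \<cdot> (\<psi> \<otimes> \<iota> A)" "\<psi> \<cdot> (\<iota> X \<otimes> \<eta>) = \<eta> \<otimes> \<iota> X"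
    using assms(2) by (simp_all add: TransferR_Ob)
  have "mate X Y d X Y d (A \<boxtimes> A) A (\<psi> \<cdot> (\<iota> X \<otimes> m)) (\<phi> \<cdot> (m \<otimes> \<iota> Y))"
    by (rule mate_pre[OF mt dp dp]) (simp_all add: Hom_def)
  moreover have "mate X Y d X Y d (A \<boxtimes> A) A ((m \<otimes> \<iota> X) \<cdot> (\<iota> A \<otimes> \<psi>) \<cdot> (\<psi> \<otimes> \<iota> A))
      ((\<iota> Y \<otimes> m) \<cdot> (\<phi> \<otimes> \<iota> A) \<cdot> (\<iota> A \<otimes> \<phi>))"
    by (rule mate_post[OF mate_Comp[OF mt mt dp dp dp] dp dp]) (simp_all add: diagram_simps)
  ultimately have 1: "\<phi> \<cdot> (m \<otimes> \<iota> Y) = (\<iota> Y \<otimes> m) \<cdot> (\<phi> \<otimes> \<iota> A) \<cdot> (\<iota> A \<otimes> \<phi>)"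
    unfolding \<psi> by (rule mate_unique[OF _ _ dp]) (simp_all add: diagram_simps)
  have "mate X Y d X Y d \<one> A (\<psi> \<cdot> (\<iota> X \<otimes> \<eta>)) (\<phi> \<cdot> (\<eta> \<otimes> \<iota> Y))"
    by (rule mate_pre[OF mt dp dp]) (simp_all add: Hom_def)
  moreover have "mate X Y d X Y d \<one> A (\<eta> \<otimes> \<iota> X) (\<iota> Y \<otimes> \<eta>)"
    using mate_post[OF mate_Ident[OF dp] dp dp, of \<eta> A] by (simp add: diagram_simps)
  ultimately have "\<phi> \<cdot> (\<eta> \<otimes> \<iota> Y) = \<iota> Y \<otimes> \<eta>"
    unfolding \<psi> by (rule mate_unique[OF _ _ dp]) (simp_all add: diagram_simps)
  with 1 show ?thesis by (simp add: TransferL_Ob diagram_simps)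
qed

text \<open>Both sides of the arrow condition are pastings of \<open>f\<close> with an object
  square, followed by \<open>m\<close>. Since pasting reverses order, the left side of the condition
  in \<open>TR\<close> corresponds to the right side in \<open>TL\<close>, and conversely.\<close>

lemma mate_ar_Ar:
  assumes "mate_ar d d' F G" "F \<in> Ar TR"
  shows "G \<in> Ar TL"
proof -
  obtain X \<psi> f X' \<psi>' where F: "F = ((X, \<psi>), f, (X', \<psi>'))" by (metis prod.exhaust)
  obtain Y' \<phi>' g Y \<phi> where G: "G = ((Y', \<phi>'), g, (Y, \<phi>))" by (metis prod.exhaust)
  have ob: "mate_ob d (X, \<psi>) (Y, \<phi>)" "mate_ob d' (X', \<psi>') (Y', \<phi>')" and mf: "mate X Y d X' Y' d' \<one> A f g"
    using assms(1) by (simp_all add: mate_ar_iff F G)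
  have dp: "dual_pair X Y d" and mt: "mate X Y d X Y d A A \<psi> \<phi>"
    and dp': "dual_pair X' Y' d'" and mt': "mate X' Y' d' X' Y' d' A A \<psi>' \<phi>'"
    using ob by (simp_all add: mate_ob_iff)
  note [simp] = dual_pairD[OF dp] mateD(1-6)[OF mt] dual_pairD[OF dp'] mateD(1-6)[OF mt'] mateD(1-6)[OF mf]
  have Ob: "(X, \<psi>) \<in> Ob TR" "(X', \<psi>') \<in> Ob TR"
    and f: "(m \<otimes> \<iota> X') \<cdot> (\<iota> A \<otimes> f) \<cdot> \<psi> = (m \<otimes> \<iota> X') \<cdot> (\<iota> A \<otimes> \<psi>') \<cdot> (f \<otimes> \<iota> A)"
    using assms(2) by (simp_all add: F TransferR_Ar)
  have "mate X Y d X' Y' d' (A \<boxtimes> \<one>) A ((m \<otimes> \<iota> X') \<cdot> (\<iota> A \<otimes> f) \<cdot> (\<psi> \<otimes> \<iota> \<one>))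
      ((\<iota> Y \<otimes> m) \<cdot> (\<phi> \<otimes> \<iota> A) \<cdot> (\<iota> A \<otimes> g))"
    by (rule mate_post[OF mate_Comp[OF mt mf dp dp dp'] dp dp']) (simp_all add: diagram_simps)
  then have 1: "mate X Y d X' Y' d' A A ((m \<otimes> \<iota> X') \<cdot> (\<iota> A \<otimes> f) \<cdot> \<psi>)
      ((\<iota> Y \<otimes> m) \<cdot> (\<phi> \<otimes> \<iota> A) \<cdot> (\<iota> A \<otimes> g))"
    by (simp add: TensorOb_Unit TensorAr_Unit)
  have "mate X Y d X' Y' d' (\<one> \<boxtimes> A) A ((m \<otimes> \<iota> X') \<cdot> (\<iota> A \<otimes> \<psi>') \<cdot> (f \<otimes> \<iota> A))
      ((\<iota> Y \<otimes> m) \<cdot> (g \<otimes> \<iota> A) \<cdot> (\<iota> \<one> \<otimes> \<phi>'))"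
    by (rule mate_post[OF mate_Comp[OF mf mt' dp dp' dp'] dp dp']) (simp_all add: diagram_simps)
  then have "mate X Y d X' Y' d' A A ((m \<otimes> \<iota> X') \<cdot> (\<iota> A \<otimes> \<psi>') \<cdot> (f \<otimes> \<iota> A))
      ((\<iota> Y \<otimes> m) \<cdot> (g \<otimes> \<iota> A) \<cdot> \<phi>')"
    by (simp add: Unit_TensorOb Unit_TensorAr)
  then have "(\<iota> Y \<otimes> m) \<cdot> (g \<otimes> \<iota> A) \<cdot> \<phi>' = (\<iota> Y \<otimes> m) \<cdot> (\<phi> \<otimes> \<iota> A) \<cdot> (\<iota> A \<otimes> g)"
    using 1 unfolding f by (rule mate_unique[OF _ _ dp]) simp_all
  moreover have "g \<in> Hom C Y' (Y \<boxtimes> A)" by (simp add: diagram_simps)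
  ultimately show ?thesis
    using mate_ob_Ob[OF ob(1) Ob(1)] mate_ob_Ob[OF ob(2) Ob(2)] by (simp add: G TransferL_Ar)
qed

lemma mate_ob_Unit: "mate_ob (\<iota> \<one>) (Unit TR) (Unit TL)"
  using adjunction_Unit by (auto simp: TransferR_sel TransferL_sel mate_ob_iff dual_pair_def mate_def diagram_simps)

lemma mate_ob_Tensor:
  assumes "mate_ob d (X, \<psi>) (Y, \<phi>)" "mate_ob e (R, \<rho>) (S, \<sigma>)"
  shows "mate_ob (counit_comp R S e d) (TensorOb TR (R, \<rho>) (X, \<psi>)) (TensorOb TL (Y, \<phi>) (S, \<sigma>))"
  using assms by (auto simp: mate_ob_iff TransferR_sel TransferL_sel intro: dual_pair_comp mate_Tensor)

lemma mate_ar_Ident: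
  assumes "mate_ob d x y"
  shows "mate_ar d d (Ident TR x) (Ident TL y)"
proof -
  obtain X \<psi> Y \<phi> where [simp]: "x = (X, \<psi>)" "y = (Y, \<phi>)" by (cases x, cases y)
  have dp: "dual_pair X Y d" using assms(1) by (simp_all add: mate_ob_iff)
  note [simp] = dual_pairD[OF dp]
  have "mate X Y d X Y d \<one> A ((\<eta> \<otimes> \<iota> X) \<cdot> \<iota> X) ((\<iota> Y \<otimes> \<eta>) \<cdot> \<iota> Y)"
    by (rule mate_post[OF mate_Ident[OF dp] dp dp]) (simp_all add: diagram_simps)
  then show ?thesis
    using assms by (simp add: mate_ar_iff TransferR_sel TransferL_sel diagram_simps)
qed

text \<open>Composition in either category is horizontal pasting followed by \<open>m\<close>, and
  pasting is reversed on the right adjoints.\<close>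

lemma mate_ar_Comp:
  assumes "mate_ar d d' F G" "mate_ar d' d'' F' G'" "Dom TR F' = Cod TR F" "Cod TL G' = Dom TL G"
  shows "mate_ar d d'' (Comp TR F' F) (Comp TL G G')"
proof -
  obtain X \<psi> f X' \<psi>' where F: "F = ((X, \<psi>), f, (X', \<psi>'))" by (metis prod.exhaust)
  obtain Y' \<phi>' g Y \<phi> where G: "G = ((Y', \<phi>'), g, (Y, \<phi>))" by (metis prod.exhaust)
  obtain f' X'' \<psi>'' where F': "F' = ((X', \<psi>'), f', (X'', \<psi>''))"
    using assms(3) F by (metis prod.exhaust TransferR_sel(1,2))
  obtain Y'' \<phi>'' g' where G': "G' = ((Y'', \<phi>''), g', (Y', \<phi>'))"
    using assms(4) G by (metis prod.exhaust TransferL_sel(1,2))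
  have ob: "mate_ob d (X, \<psi>) (Y, \<phi>)" "mate_ob d' (X', \<psi>') (Y', \<phi>')" "mate_ob d'' (X'', \<psi>'') (Y'', \<phi>'')"
    and mf: "mate X Y d X' Y' d' \<one> A f g" and mf': "mate X' Y' d' X'' Y'' d'' \<one> A f' g'"
    using assms(1,2) by (simp_all add: mate_ar_iff F G F' G')
  have dp: "dual_pair X Y d" and dp': "dual_pair X' Y' d'" and dp'': "dual_pair X'' Y'' d''"
    using ob by (simp_all add: mate_ob_iff)
  note [simp] = dual_pairD[OF dp] dual_pairD[OF dp'] dual_pairD[OF dp''] mateD(1-6)[OF mf] mateD(1-6)[OF mf']
  \<comment> \<open>Arrows are squares with \<open>U = \<one>\<close>, so pasting produces
    \<open>\<one> \<boxtimes> \<one>\<close>, which strictness removes afterwards.\<close>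
  have "mate X Y d X'' Y'' d'' (\<one> \<boxtimes> \<one>) A ((m \<otimes> \<iota> X'') \<cdot> (\<iota> A \<otimes> f') \<cdot> (f \<otimes> \<iota> \<one>))
      ((\<iota> Y \<otimes> m) \<cdot> (g \<otimes> \<iota> A) \<cdot> (\<iota> \<one> \<otimes> g'))"
    by (rule mate_post[OF mate_Comp[OF mf mf' dp dp' dp''] dp dp'']) (simp_all add: diagram_simps)
  then have "mate X Y d X'' Y'' d'' \<one> A ((m \<otimes> \<iota> X'') \<cdot> (\<iota> A \<otimes> f') \<cdot> f) ((\<iota> Y \<otimes> m) \<cdot> (g \<otimes> \<iota> A) \<cdot> g')"
    by (simp add: TensorOb_Unit TensorAr_Unit Unit_TensorAr Unit_in)
  then show ?thesis
    using ob by (simp add: mate_ar_iff F G F' G' TransferR_sel TransferL_sel)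
qed

text \<open>The tensor product in \<open>TR\<close> is split into two steps, first \<open>h\<close>
  beside \<open>P\<close>, then \<open>f\<close> beside \<open>R'\<close>, which are pasted. The
  resulting mate lets \<open>\<sigma>'\<close> act before \<open>k\<close>, whereas the tensor
  product in \<open>TL\<close> lets \<open>\<sigma>\<close> act after \<open>k\<close>; the arrow
  condition for \<open>k\<close> reconciles the two.\<close>

lemma mate_ar_Tensor:
  assumes "mate_ar d d' F G" "mate_ar e e' F' G'" "F' \<in> Ar TR"
    "R = fst (Dom TR F')" "R' = fst (Cod TR F')" "S' = fst (Dom TL G')" "S = fst (Cod TL G')"
  shows "mate_ar (counit_comp R S e d) (counit_comp R' S' e' d') (TensorAr TR F' F) (TensorAr TL G G')"
proof -
  obtain P \<psi> f P' \<psi>' where F: "F = ((P, \<psi>), f, (P', \<psi>'))" by (metis prod.exhaust)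
  obtain Q' \<phi>' g Q \<phi> where G: "G = ((Q', \<phi>'), g, (Q, \<phi>))" by (metis prod.exhaust)
  obtain \<rho> h \<rho>' where F': "F' = ((R, \<rho>), h, (R', \<rho>'))"
    using assms(4,5) by (cases F') (auto simp: TransferR_sel)
  obtain \<sigma>' k \<sigma> where G': "G' = ((S', \<sigma>'), k, (S, \<sigma>))"
    using assms(6,7) by (cases G') (auto simp: TransferL_sel)
  have ob: "mate_ob d (P, \<psi>) (Q, \<phi>)" "mate_ob d' (P', \<psi>') (Q', \<phi>')"
    "mate_ob e (R, \<rho>) (S, \<sigma>)" "mate_ob e' (R', \<rho>') (S', \<sigma>')"
    and mf: "mate P Q d P' Q' d' \<one> A f g" and mh: "mate R S e R' S' e' \<one> A h k"
    using assms(1,2) by (simp_all add: mate_ar_iff F G F' G')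
  have P: "dual_pair P Q d" "dual_pair P' Q' d'"
    and R: "dual_pair R S e" "dual_pair R' S' e'"
    and m\<sigma>: "mate R S e R S e A A \<rho> \<sigma>" and m\<sigma>': "mate R' S' e' R' S' e' A A \<rho>' \<sigma>'"
    using ob by (simp_all add: mate_ob_iff)
  note [simp] = dual_pairD[OF P(1)] dual_pairD[OF P(2)] dual_pairD[OF R(1)] dual_pairD[OF R(2)]
    mateD(1-6)[OF mf] mateD(1-6)[OF mh] mateD(1-6)[OF m\<sigma>] mateD(1-6)[OF m\<sigma>']
  \<comment> \<open>The mate of an arrow of \<open>TR\<close> is an arrow of \<open>TL\<close>; this
    is where \<open>F' \<in> Ar TR\<close> enters.\<close>
  have k: "(\<iota> S \<otimes> m) \<cdot> (k \<otimes> \<iota> A) \<cdot> \<sigma>' = (\<iota> S \<otimes> m) \<cdot> (\<sigma> \<otimes> \<iota> A) \<cdot> (\<iota> A \<otimes> k)"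
    using mate_ar_Ar[OF assms(2,3)] by (simp add: G' TransferL_Ar)
  let ?c = "counit_comp R S e d" let ?c' = "counit_comp R' S' e' d" let ?c'' = "counit_comp R' S' e' d'"
  have dp: "dual_pair (R \<boxtimes> P) (Q \<boxtimes> S) ?c" "dual_pair (R' \<boxtimes> P) (Q \<boxtimes> S') ?c'"
    "dual_pair (R' \<boxtimes> P') (Q' \<boxtimes> S') ?c''"
    using P R by (simp_all add: dual_pair_comp)
  \<comment> \<open>The step \<open>?f1\<close> tensors with an identity square whose side strands
    are \<open>\<one>\<close>. In \<open>?f2\<close> the strand \<open>A\<close> emitted by
    \<open>f\<close> crosses \<open>R'\<close> through \<open>\<rho>'\<close>.\<close>
  let ?f1 = "(h \<otimes> \<iota> P) \<cdot> (\<iota> R \<otimes> \<iota> P)" let ?g1 = "(\<iota> Q \<otimes> k) \<cdot> (\<iota> Q \<otimes> \<iota> S')"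
  let ?f2 = "(\<rho>' \<otimes> \<iota> P') \<cdot> (\<iota> R' \<otimes> f)" let ?g2 = "(\<iota> Q \<otimes> \<sigma>') \<cdot> (g \<otimes> \<iota> S')"
  have m1: "mate (R \<boxtimes> P) (Q \<boxtimes> S) ?c (R' \<boxtimes> P) (Q \<boxtimes> S') ?c' \<one> A ?f1 ?g1"
    by (rule mate_Tensor[OF mate_Ident[OF P(1)] mh P(1) P(1) R]) (simp_all add: diagram_simps)
  have m2: "mate (R' \<boxtimes> P) (Q \<boxtimes> S') ?c' (R' \<boxtimes> P') (Q' \<boxtimes> S') ?c'' \<one> A ?f2 ?g2"
    by (rule mate_Tensor[OF mf m\<sigma>' P R(2) R(2)]) (simp_all add: diagram_simps)
  have m3: "mate (R \<boxtimes> P) (Q \<boxtimes> S) ?c (R' \<boxtimes> P') (Q' \<boxtimes> S') ?c'' (\<one> \<boxtimes> \<one>) A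
    ((m \<otimes> \<iota> (R' \<boxtimes> P')) \<cdot> (\<iota> A \<otimes> ?f2) \<cdot> (?f1 \<otimes> \<iota> \<one>))
    ((\<iota> (Q \<boxtimes> S) \<otimes> m) \<cdot> (?g1 \<otimes> \<iota> A) \<cdot> (\<iota> \<one> \<otimes> ?g2))"
    by (rule mate_post[OF mate_Comp[OF m1 m2 dp] dp(1,3)]) (simp_all add: diagram_simps)
  have s: "wh \<one> h (A \<boxtimes> P') \<cdot> wh R f \<one> = wh (A \<boxtimes> R') f \<one> \<cdot> wh \<one> h P"
    using slide[of h f \<one> \<one> \<one>] by (simp add: diagram_simps)
  have f: "(m \<otimes> \<iota> (R' \<boxtimes> P')) \<cdot> (\<iota> A \<otimes> ?f2) \<cdot> (?f1 \<otimes> \<iota> \<one>)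
    = (m \<otimes> \<iota> R' \<otimes> \<iota> P') \<cdot> (\<iota> A \<otimes> \<rho>' \<otimes> \<iota> P') \<cdot> (h \<otimes> f)"
    by (simp add: diagram_simps s)
  have s': "wh \<one> g (S \<boxtimes> A) \<cdot> wh Q' k \<one> = wh (Q \<boxtimes> A) k \<one> \<cdot> wh \<one> g S'"
    using slide[of g k \<one> \<one> \<one>] by (simp add: diagram_simps)
  have "(\<iota> (Q \<boxtimes> S) \<otimes> m) \<cdot> (?g1 \<otimes> \<iota> A) \<cdot> (\<iota> \<one> \<otimes> ?g2)
    = wh Q ((\<iota> S \<otimes> m) \<cdot> (k \<otimes> \<iota> A) \<cdot> \<sigma>') \<one> \<cdot> wh \<one> g S'"
    by (simp add: diagram_simps)
  also have "\<dots> = (\<iota> Q \<otimes> \<iota> S \<otimes> m) \<cdot> (\<iota> Q \<otimes> \<sigma> \<otimes> \<iota> A) \<cdot> (g \<otimes> k)"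
    unfolding k by (simp add: diagram_simps s')
  finally have "mate (R \<boxtimes> P) (Q \<boxtimes> S) ?c (R' \<boxtimes> P') (Q' \<boxtimes> S') ?c'' \<one> A
    ((m \<otimes> \<iota> R' \<otimes> \<iota> P') \<cdot> (\<iota> A \<otimes> \<rho>' \<otimes> \<iota> P') \<cdot> (h \<otimes> f))
    ((\<iota> Q \<otimes> \<iota> S \<otimes> m) \<cdot> (\<iota> Q \<otimes> \<sigma> \<otimes> \<iota> A) \<cdot> (g \<otimes> k))"
    using m3 unfolding f by (simp add: TensorOb_Unit Unit_in)
  then show ?thesis
    using mate_ob_Tensor[OF ob(1,3)] mate_ob_Tensor[OF ob(2,4)]
    by (simp add: F G F' G' TransferR_sel TransferL_sel mate_ar_iff)
qed

lemma mate_ar_unique: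
  assumes "mate_ar d d' F G" "mate_ar d d' F G'" "Dom TL G = Dom TL G'" "Cod TL G = Cod TL G'"
  shows "G = G'"
proof -
  obtain X \<psi> f X' \<psi>' where F: "F = ((X, \<psi>), f, (X', \<psi>'))" by (metis prod.exhaust)
  obtain Y' \<phi>' g Y \<phi> where G: "G = ((Y', \<phi>'), g, (Y, \<phi>))" by (metis prod.exhaust)
  obtain g' where G': "G' = ((Y', \<phi>'), g', (Y, \<phi>))"
    using assms(3,4) G by (metis prod.exhaust TransferL_sel(1,2))
  have "mate X Y d X' Y' d' \<one> A f g" "mate X Y d X' Y' d' \<one> A f g'"
    "dual_pair X Y d" "dual_pair X' Y' d'"
    using assms(1,2) by (simp_all add: F G G' mate_ar_iff mate_ob_iff)
  then have "g = g'" using mate_unique dual_pairD(2) A_typing(1) Unit_in by metis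
  then show ?thesis by (simp add: G G')
qed

section \<open>Endpoints and identities in the transfer categories\<close>

lemma TensorOb_TL_assoc:
  assumes "x \<in> Ob TL" "y \<in> Ob TL" "z \<in> Ob TL"
  shows "TensorOb TL (TensorOb TL x y) z = TensorOb TL x (TensorOb TL y z)"
  using assms by (cases x; cases y; cases z) (auto simp: TransferL_Ob TransferL_sel diagram_simps)

lemma TensorOb_TL_Unit:
  assumes "y \<in> Ob TL"
  shows "TensorOb TL y (Unit TL) = y" "TensorOb TL (Unit TL) y = y"
  using assms by (cases y; auto simp: TransferL_Ob TransferL_sel diagram_simps)+

lemma TL_Dom_Cod:
  "Dom TL (Comp TL G F) = Dom TL F" "Cod TL (Comp TL G F) = Cod TL G"
  "Dom TL (TensorAr TL F G) = TensorOb TL (Dom TL F) (Dom TL G)"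
  "Cod TL (TensorAr TL F G) = TensorOb TL (Cod TL F) (Cod TL G)"
  "Dom TL (Ident TL y) = y" "Cod TL (Ident TL y) = y"
  by (cases F; cases G; cases y; auto simp: TransferL_sel)+

lemma TR_Dom_Cod:
  "Dom TR (Comp TR G F) = Dom TR F" "Cod TR (Comp TR G F) = Cod TR G"
  "Dom TR (TensorAr TR F G) = TensorOb TR (Dom TR F) (Dom TR G)"
  "Cod TR (TensorAr TR F G) = TensorOb TR (Cod TR F) (Cod TR G)"
  "Dom TR (Ident TR y) = y" "Cod TR (Ident TR y) = y"
  by (cases F; cases G; cases y; auto simp: TransferR_sel)+

text \<open>Supplies the premise of \<open>mate_ar_Tensor\<close> when the left factor is an
  identity. By the unit laws of \<open>A\<close>, both sides of the arrow condition reduce to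
  \<open>\<psi>\<close>.\<close>

lemma Ident_TR_Ar:
  assumes "x \<in> Ob TR"
  shows "Ident TR x \<in> Ar TR"
proof -
  obtain X \<psi> where x: "x = (X, \<psi>)" by (cases x)
  have [simp]: "X \<in> Ob C" "\<psi> \<in> Ar C" "Dom C \<psi> = X \<boxtimes> A" "Cod C \<psi> = A \<boxtimes> X"
    and \<psi>: "\<psi> \<cdot> (\<iota> X \<otimes> \<eta>) = \<eta> \<otimes> \<iota> X"
    using assms by (simp_all add: x TransferR_Ob Hom_def)
  have u: "m \<cdot> (\<eta> \<otimes> \<iota> A) = \<iota> A" "m \<cdot> (\<iota> A \<otimes> \<eta>) = \<iota> A"
    using alg by (simp_all add: algebra_in_def)
  have s: "wh \<one> \<eta> (A \<boxtimes> X) \<cdot> \<psi> = wh A \<psi> \<one> \<cdot> wh \<one> \<eta> (X \<boxtimes> A)"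
    using slide[of \<eta> \<psi> \<one> \<one> \<one>] by (simp add: diagram_simps)
  have "(m \<otimes> \<iota> X) \<cdot> (\<iota> A \<otimes> \<eta> \<otimes> \<iota> X) \<cdot> \<psi> = wh \<one> (m \<cdot> (\<iota> A \<otimes> \<eta>)) X \<cdot> \<psi>"
    by (simp add: diagram_simps)
  also have "\<dots> = wh \<one> (m \<cdot> (\<eta> \<otimes> \<iota> A)) X \<cdot> \<psi>"
    unfolding u ..
  also have "\<dots> = (m \<otimes> \<iota> X) \<cdot> wh \<one> \<eta> (A \<boxtimes> X) \<cdot> \<psi>"
    by (simp add: diagram_simps)
  also have "\<dots> = (m \<otimes> \<iota> X) \<cdot> (\<iota> A \<otimes> \<psi>) \<cdot> ((\<eta> \<otimes> \<iota> X) \<otimes> \<iota> A)"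
    unfolding s by (simp add: diagram_simps)
  finally show ?thesis
    using assms by (simp add: x TransferR_sel TransferR_Ar Hom_def typing_simps)
qed

section \<open>Exchange of algebras and coalgebras under duality\<close>

text \<open>Each algebra axiom in \<open>TL\<close> equates mates of the two sides of a coalgebra
  axiom in \<open>TR\<close>. As tensor products are reversed, the left counit law yields the right
  unit law and conversely.\<close>

lemma dual_algebra:
  assumes ob: "mate_ob d (X, \<psi>) (Y, \<phi>)" and co: "coalgebra_in TR (X, \<psi>) F\<^sub>\<delta> F\<^sub>\<epsilon>"
    and \<delta>: "mate_ar d (counit_comp X Y d d) F\<^sub>\<delta> G\<^sub>\<delta>" and \<epsilon>: "mate_ar d (\<iota> \<one>) F\<^sub>\<epsilon> G\<^sub>\<epsilon>"
    and G\<delta>: "Dom TL G\<^sub>\<delta> = TensorOb TL (Y, \<phi>) (Y, \<phi>)" "Cod TL G\<^sub>\<delta> = (Y, \<phi>)"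
    and G\<epsilon>: "Dom TL G\<^sub>\<epsilon> = Unit TL" "Cod TL G\<^sub>\<epsilon> = (Y, \<phi>)"
  shows "algebra_in TL (Y, \<phi>) G\<^sub>\<delta> G\<^sub>\<epsilon>"
proof -
  let ?x = "(X, \<psi>)" let ?y = "(Y, \<phi>)"
  have x: "?x \<in> Ob TR" and F: "F\<^sub>\<delta> \<in> Ar TR" "F\<^sub>\<epsilon> \<in> Ar TR" "Dom TR F\<^sub>\<delta> = ?x" "Cod TR F\<^sub>\<delta> = TensorOb TR ?x ?x"
    "Dom TR F\<^sub>\<epsilon> = ?x" "Cod TR F\<^sub>\<epsilon> = Unit TR"
    and eqs: "Comp TR (TensorAr TR F\<^sub>\<delta> (Ident TR ?x)) F\<^sub>\<delta> = Comp TR (TensorAr TR (Ident TR ?x) F\<^sub>\<delta>) F\<^sub>\<delta>"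
     "Comp TR (TensorAr TR F\<^sub>\<epsilon> (Ident TR ?x)) F\<^sub>\<delta> = Ident TR ?x"
     "Comp TR (TensorAr TR (Ident TR ?x) F\<^sub>\<epsilon>) F\<^sub>\<delta> = Ident TR ?x"
    using co by (auto simp: coalgebra_in_def Hom_def)
  have y: "?y \<in> Ob TL" by (rule mate_ob_Ob[OF ob x])
  have dp: "dual_pair X Y d" using ob by (simp add: mate_ob_iff)
  have id: "mate_ar d d (Ident TR ?x) (Ident TL ?y)" by (rule mate_ar_Ident[OF ob])
  note GG = G\<delta> G\<epsilon>
  note dc = TL_Dom_Cod TR_Dom_Cod F GG TransferR_sel(5,6) TransferL_sel(5,6)
  have \<delta>1: "mate_ar (counit_comp X Y d d) (counit_comp (X \<boxtimes> X) (Y \<boxtimes> Y) (counit_comp X Y d d) d)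
      (TensorAr TR F\<^sub>\<delta> (Ident TR ?x)) (TensorAr TL (Ident TL ?y) G\<^sub>\<delta>)"
    by (rule mate_ar_Tensor[OF id \<delta> F(1)]) (simp_all add: dc)
  have \<delta>2: "mate_ar (counit_comp X Y d d) (counit_comp X Y d (counit_comp X Y d d))
      (TensorAr TR (Ident TR ?x) F\<^sub>\<delta>) (TensorAr TL G\<^sub>\<delta> (Ident TL ?y))"
    by (rule mate_ar_Tensor[OF \<delta> id Ident_TR_Ar[OF x]]) (simp_all add: dc)
  have \<epsilon>1: "mate_ar (counit_comp X Y d d) (counit_comp \<one> \<one> (\<iota> \<one>) d)
      (TensorAr TR F\<^sub>\<epsilon> (Ident TR ?x)) (TensorAr TL (Ident TL ?y) G\<^sub>\<epsilon>)"
    by (rule mate_ar_Tensor[OF id \<epsilon> F(2)]) (simp_all add: dc)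
  have \<epsilon>2: "mate_ar (counit_comp X Y d d) (counit_comp X Y d (\<iota> \<one>))
      (TensorAr TR (Ident TR ?x) F\<^sub>\<epsilon>) (TensorAr TL G\<^sub>\<epsilon> (Ident TL ?y))"
    by (rule mate_ar_Tensor[OF \<epsilon> id Ident_TR_Ar[OF x]]) (simp_all add: dc)
  note comp = mate_ar_Comp[OF \<delta> \<delta>1] mate_ar_Comp[OF \<delta> \<delta>2] mate_ar_Comp[OF \<delta> \<epsilon>1] mate_ar_Comp[OF \<delta> \<epsilon>2]
  \<comment> \<open>After rewriting with the coalgebra axioms and the identities between counits,
    the pairs to be compared are mates of one and the same arrow over the same counits.\<close>
  note comp = comp[unfolded eqs counit_comp_assoc[OF dp dp dp] counit_comp_Unit[OF dp]]
  have "Comp TL G\<^sub>\<delta> (TensorAr TL G\<^sub>\<delta> (Ident TL ?y)) = Comp TL G\<^sub>\<delta> (TensorAr TL (Ident TL ?y) G\<^sub>\<delta>)"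
    by (rule mate_ar_unique[OF comp(2,1)]) (simp_all only: TL_Dom_Cod TR_Dom_Cod F GG TensorOb_TL_assoc[OF y y y] TensorOb_TL_Unit[OF y])
  moreover have "Comp TL G\<^sub>\<delta> (TensorAr TL G\<^sub>\<epsilon> (Ident TL ?y)) = Ident TL ?y"
    by (rule mate_ar_unique[OF comp(4) id]) (simp_all only: TL_Dom_Cod TR_Dom_Cod F GG TensorOb_TL_assoc[OF y y y] TensorOb_TL_Unit[OF y])
  moreover have "Comp TL G\<^sub>\<delta> (TensorAr TL (Ident TL ?y) G\<^sub>\<epsilon>) = Ident TL ?y"
    by (rule mate_ar_unique[OF comp(3) id]) (simp_all only: TL_Dom_Cod TR_Dom_Cod F GG TensorOb_TL_assoc[OF y y y] TensorOb_TL_Unit[OF y])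
  ultimately show ?thesis
    using mate_ar_Ar[OF \<delta> F(1)] mate_ar_Ar[OF \<epsilon> F(2)] y
    by (simp add: algebra_in_def Hom_def G\<delta> G\<epsilon>)
qed

text \<open>The argument of \<open>dual_algebra\<close> with all arrows reversed: the composite
  counits now belong to the sources of the arrows in \<open>TR\<close> instead of the
  targets.\<close>

lemma dual_coalgebra:
  assumes ob: "mate_ob d (X, \<psi>) (Y, \<phi>)" and al: "algebra_in TR (X, \<psi>) F\<^sub>m F\<^sub>\<eta>"
    and m: "mate_ar (counit_comp X Y d d) d F\<^sub>m G\<^sub>m" and \<eta>: "mate_ar (\<iota> \<one>) d F\<^sub>\<eta> G\<^sub>\<eta>"
    and Gm: "Cod TL G\<^sub>m = TensorOb TL (Y, \<phi>) (Y, \<phi>)" "Dom TL G\<^sub>m = (Y, \<phi>)"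
    and G\<eta>: "Cod TL G\<^sub>\<eta> = Unit TL" "Dom TL G\<^sub>\<eta> = (Y, \<phi>)"
  shows "coalgebra_in TL (Y, \<phi>) G\<^sub>m G\<^sub>\<eta>"
proof -
  let ?x = "(X, \<psi>)" let ?y = "(Y, \<phi>)"
  have x: "?x \<in> Ob TR" and F: "F\<^sub>m \<in> Ar TR" "F\<^sub>\<eta> \<in> Ar TR" "Cod TR F\<^sub>m = ?x" "Dom TR F\<^sub>m = TensorOb TR ?x ?x"
    "Cod TR F\<^sub>\<eta> = ?x" "Dom TR F\<^sub>\<eta> = Unit TR"
    and eqs: "Comp TR F\<^sub>m (TensorAr TR F\<^sub>m (Ident TR ?x)) = Comp TR F\<^sub>m (TensorAr TR (Ident TR ?x) F\<^sub>m)"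
     "Comp TR F\<^sub>m (TensorAr TR F\<^sub>\<eta> (Ident TR ?x)) = Ident TR ?x"
     "Comp TR F\<^sub>m (TensorAr TR (Ident TR ?x) F\<^sub>\<eta>) = Ident TR ?x"
    using al by (auto simp: algebra_in_def Hom_def)
  have y: "?y \<in> Ob TL" by (rule mate_ob_Ob[OF ob x])
  have dp: "dual_pair X Y d" using ob by (simp add: mate_ob_iff)
  have id: "mate_ar d d (Ident TR ?x) (Ident TL ?y)" by (rule mate_ar_Ident[OF ob])
  note GG = Gm G\<eta>
  note dc = TL_Dom_Cod TR_Dom_Cod F GG TransferR_sel(5,6) TransferL_sel(5,6)
  have m1: "mate_ar (counit_comp (X \<boxtimes> X) (Y \<boxtimes> Y) (counit_comp X Y d d) d) (counit_comp X Y d d)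
      (TensorAr TR F\<^sub>m (Ident TR ?x)) (TensorAr TL (Ident TL ?y) G\<^sub>m)"
    by (rule mate_ar_Tensor[OF id m F(1)]) (simp_all add: dc)
  have m2: "mate_ar (counit_comp X Y d (counit_comp X Y d d)) (counit_comp X Y d d)
      (TensorAr TR (Ident TR ?x) F\<^sub>m) (TensorAr TL G\<^sub>m (Ident TL ?y))"
    by (rule mate_ar_Tensor[OF m id Ident_TR_Ar[OF x]]) (simp_all add: dc)
  have \<eta>1: "mate_ar (counit_comp \<one> \<one> (\<iota> \<one>) d) (counit_comp X Y d d)
      (TensorAr TR F\<^sub>\<eta> (Ident TR ?x)) (TensorAr TL (Ident TL ?y) G\<^sub>\<eta>)"
    by (rule mate_ar_Tensor[OF id \<eta> F(2)]) (simp_all add: dc)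
  have \<eta>2: "mate_ar (counit_comp X Y d (\<iota> \<one>)) (counit_comp X Y d d)
      (TensorAr TR (Ident TR ?x) F\<^sub>\<eta>) (TensorAr TL G\<^sub>\<eta> (Ident TL ?y))"
    by (rule mate_ar_Tensor[OF \<eta> id Ident_TR_Ar[OF x]]) (simp_all add: dc)
  note comp = mate_ar_Comp[OF m1 m] mate_ar_Comp[OF m2 m] mate_ar_Comp[OF \<eta>1 m] mate_ar_Comp[OF \<eta>2 m]
  note comp = comp[unfolded eqs counit_comp_assoc[OF dp dp dp] counit_comp_Unit[OF dp]]
  have "Comp TL (TensorAr TL G\<^sub>m (Ident TL ?y)) G\<^sub>m = Comp TL (TensorAr TL (Ident TL ?y) G\<^sub>m) G\<^sub>m"
    by (rule mate_ar_unique[OF comp(2,1)]) (simp_all only: TL_Dom_Cod TR_Dom_Cod F GG TensorOb_TL_assoc[OF y y y] TensorOb_TL_Unit[OF y])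
  moreover have "Comp TL (TensorAr TL G\<^sub>\<eta> (Ident TL ?y)) G\<^sub>m = Ident TL ?y"
    by (rule mate_ar_unique[OF comp(4) id]) (simp_all only: TL_Dom_Cod TR_Dom_Cod F GG TensorOb_TL_assoc[OF y y y] TensorOb_TL_Unit[OF y])
  moreover have "Comp TL (TensorAr TL (Ident TL ?y) G\<^sub>\<eta>) G\<^sub>m = Ident TL ?y"
    by (rule mate_ar_unique[OF comp(3) id]) (simp_all only: TL_Dom_Cod TR_Dom_Cod F GG TensorOb_TL_assoc[OF y y y] TensorOb_TL_Unit[OF y])
  ultimately show ?thesis
    using mate_ar_Ar[OF m F(1)] mate_ar_Ar[OF \<eta> F(2)] y
    by (simp add: coalgebra_in_def Hom_def Gm G\<eta>)
qed

subsection \<open>The wreath product\<close>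

text \<open>
  \<open>act\<close> is the left action of \<open>A\<close> on \<open>YA\<close> and \<open>\<rho>\<close> the right \<open>A\<close>-linear extension of \<open>M\<close>. Both are
  right \<open>A\<close>-linear, and the wreath product multiplication is \<open>\<mu> = \<rho> \<circ> Y act\<close>. Extending
  the axioms \<open>A\<close>-linearly gives \<open>\<rho> \<circ> Y\<rho> = \<mu> \<circ> MYA\<close> and \<open>act \<circ> A\<rho> = \<mu> \<circ> \<phi>YA\<close>, from which
  associativity follows by sliding.
\<close>
lemma wreath_product_algebra:
  assumes "right_wreath C A m \<eta> Y \<phi> M N"
  shows "algebra_in C (Y \<boxtimes> A) (wreath_product_mult C A m Y \<phi> M) N"
proof -
  have al: "algebra_in TL (Y, \<phi>) (TensorOb TL (Y, \<phi>) (Y, \<phi>), M, (Y, \<phi>)) (Unit TL, N, (Y, \<phi>))"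
    using assms by (simp add: right_wreath_def Let_def)
  have Y [simp]: "Y \<in> Ob C" "\<phi> \<in> Ar C" "Dom C \<phi> = A \<boxtimes> Y" "Cod C \<phi> = Y \<boxtimes> A"
    and \<phi>m: "\<phi> \<cdot> (m \<otimes> \<iota> Y) = (\<iota> Y \<otimes> m) \<cdot> (\<phi> \<otimes> \<iota> A) \<cdot> (\<iota> A \<otimes> \<phi>)"
    and \<phi>\<eta>: "\<phi> \<cdot> (\<eta> \<otimes> \<iota> Y) = \<iota> Y \<otimes> \<eta>"
    using al by (simp_all add: algebra_in_def TransferL_Ob Hom_def)
  have M [simp]: "M \<in> Ar C" "Dom C M = Y \<boxtimes> Y" "Cod C M = Y \<boxtimes> A"
    and M\<phi>: "(\<iota> Y \<otimes> m) \<cdot> (M \<otimes> \<iota> A) \<cdot> (\<iota> Y \<otimes> \<phi>) \<cdot> (\<phi> \<otimes> \<iota> Y) = (\<iota> Y \<otimes> m) \<cdot> (\<phi> \<otimes> \<iota> A) \<cdot> (\<iota> A \<otimes> M)"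
    using al by (auto simp add: algebra_in_def Hom_def TransferL_sel TransferL_Ar)
  have N [simp]: "N \<in> Ar C" "Dom C N = \<one>" "Cod C N = Y \<boxtimes> A"
    and N\<phi>: "(\<iota> Y \<otimes> m) \<cdot> (N \<otimes> \<iota> A) \<cdot> \<iota> A = (\<iota> Y \<otimes> m) \<cdot> (\<phi> \<otimes> \<iota> A) \<cdot> (\<iota> A \<otimes> N)"
    using al by (auto simp add: algebra_in_def Hom_def TransferL_sel TransferL_Ar)
  have mm: "m \<cdot> (m \<otimes> \<iota> A) = m \<cdot> (\<iota> A \<otimes> m)" "m \<cdot> (\<eta> \<otimes> \<iota> A) = \<iota> A" "m \<cdot> (\<iota> A \<otimes> \<eta>) = \<iota> A"
    using alg by (simp_all add: algebra_in_def)
  define act where "act = (\<iota> Y \<otimes> m) \<cdot> (\<phi> \<otimes> \<iota> A)"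
  define \<rho> where "\<rho> = (\<iota> Y \<otimes> m) \<cdot> (M \<otimes> \<iota> A)"
  define \<mu> where "\<mu> = \<rho> \<cdot> (\<iota> Y \<otimes> act)"
  have [simp]: "act \<in> Ar C" "Dom C act = A \<boxtimes> Y \<boxtimes> A" "Cod C act = Y \<boxtimes> A"
    "\<rho> \<in> Ar C" "Dom C \<rho> = Y \<boxtimes> Y \<boxtimes> A" "Cod C \<rho> = Y \<boxtimes> A"
    "\<mu> \<in> Ar C" "Dom C \<mu> = Y \<boxtimes> A \<boxtimes> Y \<boxtimes> A" "Cod C \<mu> = Y \<boxtimes> A"
    by (simp_all add: act_def \<rho>_def \<mu>_def diagram_simps)
  have asc: "m \<cdot> wh \<one> m A = m \<cdot> wh A m \<one>" using mm(1) by (simp add: diagram_simps)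
  have sM: "wh \<one> M A \<cdot> wh (Y \<boxtimes> Y) m \<one> = wh (Y \<boxtimes> A) m \<one> \<cdot> wh \<one> M (A \<boxtimes> A)"
    using slide[of M m \<one> \<one> \<one>] by (simp add: diagram_simps)
  have s\<phi>: "wh \<one> \<phi> A \<cdot> wh (A \<boxtimes> Y) m \<one> = wh (Y \<boxtimes> A) m \<one> \<cdot> wh \<one> \<phi> (A \<boxtimes> A)"
    using slide[of \<phi> m \<one> \<one> \<one>] by (simp add: diagram_simps)
  have \<rho>_lin: "\<rho> \<cdot> (\<iota> Y \<otimes> \<iota> Y \<otimes> m) = (\<iota> Y \<otimes> m) \<cdot> (\<rho> \<otimes> \<iota> A)"
  proof -
    have "\<rho> \<cdot> (\<iota> Y \<otimes> \<iota> Y \<otimes> m) = wh Y (m \<cdot> wh A m \<one>) \<one> \<cdot> wh \<one> M (A \<boxtimes> A)"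
      by (simp add: \<rho>_def diagram_simps sM)
    then show ?thesis
      unfolding asc[symmetric] by (simp add: \<rho>_def diagram_simps)
  qed
  have act_lin: "act \<cdot> (\<iota> A \<otimes> \<iota> Y \<otimes> m) = (\<iota> Y \<otimes> m) \<cdot> (act \<otimes> \<iota> A)"
  proof -
    have "act \<cdot> (\<iota> A \<otimes> \<iota> Y \<otimes> m) = wh Y (m \<cdot> wh A m \<one>) \<one> \<cdot> wh \<one> \<phi> (A \<boxtimes> A)"
      by (simp add: act_def diagram_simps s\<phi>)
    then show ?thesis
      unfolding asc[symmetric] by (simp add: act_def diagram_simps)
  qed
  \<comment> \<open>Multiplicativity of \<open>\<phi>\<close>, extended linearly, says that
    \<open>act\<close> is an associative action.\<close>
  have actact: "act \<cdot> (\<iota> A \<otimes> act) = act \<cdot> (m \<otimes> \<iota> Y \<otimes> \<iota> A)"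
  proof -
    have "act \<cdot> (\<iota> A \<otimes> act) = (act \<cdot> (\<iota> A \<otimes> \<iota> Y \<otimes> m)) \<cdot> wh A \<phi> A"
      by (simp add: act_def diagram_simps)
    also have "\<dots> = (\<iota> Y \<otimes> m) \<cdot> wh \<one> ((\<iota> Y \<otimes> m) \<cdot> (\<phi> \<otimes> \<iota> A) \<cdot> (\<iota> A \<otimes> \<phi>)) A"
      unfolding act_lin by (simp add: act_def diagram_simps)
    also have "\<dots> = act \<cdot> (m \<otimes> \<iota> Y \<otimes> \<iota> A)"
      unfolding \<phi>m[symmetric] by (simp add: act_def diagram_simps)
    finally show ?thesis .
  qed
  \<comment> \<open>The linear extension of \<open>M\<phi>\<close>, the condition that
    \<open>M\<close> is an arrow of \<open>TL\<close>.\<close>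
  have act\<rho>: "act \<cdot> (\<iota> A \<otimes> \<rho>) = \<mu> \<cdot> (\<phi> \<otimes> \<iota> Y \<otimes> \<iota> A)"
  proof -
    have "act \<cdot> (\<iota> A \<otimes> \<rho>) = (act \<cdot> (\<iota> A \<otimes> \<iota> Y \<otimes> m)) \<cdot> wh A M A"
      by (simp add: \<rho>_def diagram_simps)
    also have "\<dots> = (\<iota> Y \<otimes> m) \<cdot> wh \<one> ((\<iota> Y \<otimes> m) \<cdot> (\<phi> \<otimes> \<iota> A) \<cdot> (\<iota> A \<otimes> M)) A"
      unfolding act_lin by (simp add: act_def diagram_simps)
    also have "\<dots> = ((\<iota> Y \<otimes> m) \<cdot> (\<rho> \<otimes> \<iota> A)) \<cdot> wh Y \<phi> A \<cdot> wh \<one> \<phi> (Y \<boxtimes> A)"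
      unfolding M\<phi>[symmetric] by (simp add: \<rho>_def diagram_simps)
    also have "\<dots> = \<mu> \<cdot> (\<phi> \<otimes> \<iota> Y \<otimes> \<iota> A)"
      unfolding \<rho>_lin[symmetric] by (simp add: \<mu>_def act_def diagram_simps)
    finally show ?thesis .
  qed
  have u\<eta>: "wh Y m \<one> \<cdot> wh (Y \<boxtimes> A) \<eta> \<one> = \<iota> (Y \<boxtimes> A)"
    using arg_cong[OF mm(3), of "\<lambda>f. wh Y f \<one>"] by (simp add: diagram_simps)
  have \<phi>\<eta>': "\<phi> \<cdot> wh \<one> \<eta> Y = wh Y \<eta> \<one>" using \<phi>\<eta> by (simp add: diagram_simps)
  have "Comp TL (TensorOb TL (Y, \<phi>) (Y, \<phi>), M, (Y, \<phi>))
      (TensorAr TL (TensorOb TL (Y, \<phi>) (Y, \<phi>), M, (Y, \<phi>)) (Ident TL (Y, \<phi>)))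
    = Comp TL (TensorOb TL (Y, \<phi>) (Y, \<phi>), M, (Y, \<phi>))
      (TensorAr TL (Ident TL (Y, \<phi>)) (TensorOb TL (Y, \<phi>) (Y, \<phi>), M, (Y, \<phi>)))"
    and "Comp TL (TensorOb TL (Y, \<phi>) (Y, \<phi>), M, (Y, \<phi>))
      (TensorAr TL (Unit TL, N, (Y, \<phi>)) (Ident TL (Y, \<phi>))) = Ident TL (Y, \<phi>)"
    and "Comp TL (TensorOb TL (Y, \<phi>) (Y, \<phi>), M, (Y, \<phi>))
      (TensorAr TL (Ident TL (Y, \<phi>)) (Unit TL, N, (Y, \<phi>))) = Ident TL (Y, \<phi>)"
    using al by (auto simp: algebra_in_def)
  \<comment> \<open>Identities of \<open>TL\<close> have the form \<open>Y\<eta>\<close>, so the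
    algebra axioms unfold with extra copies of \<open>\<eta>\<close>. The two absorption facts below
    remove them.\<close>
  then have T: "(\<iota> Y \<otimes> m) \<cdot> (M \<otimes> \<iota> A) \<cdot> (\<iota> Y \<otimes> \<iota> Y \<otimes> m) \<cdot> (\<iota> Y \<otimes> \<phi> \<otimes> \<iota> A) \<cdot> (M \<otimes> \<iota> Y \<otimes> \<eta>)
      = (\<iota> Y \<otimes> m) \<cdot> (M \<otimes> \<iota> A) \<cdot> (\<iota> Y \<otimes> \<iota> Y \<otimes> m) \<cdot> (\<iota> Y \<otimes> \<phi> \<otimes> \<iota> A) \<cdot> ((\<iota> Y \<otimes> \<eta>) \<otimes> M)"
    "(\<iota> Y \<otimes> m) \<cdot> (M \<otimes> \<iota> A) \<cdot> (\<iota> Y \<otimes> \<iota> Y \<otimes> m) \<cdot> (\<iota> Y \<otimes> \<phi> \<otimes> \<iota> A) \<cdot> (N \<otimes> \<iota> Y \<otimes> \<eta>) = \<iota> Y \<otimes> \<eta>"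
    "(\<iota> Y \<otimes> m) \<cdot> (M \<otimes> \<iota> A) \<cdot> (\<iota> Y \<otimes> \<iota> Y \<otimes> m) \<cdot> (\<iota> Y \<otimes> \<phi> \<otimes> \<iota> A) \<cdot> ((\<iota> Y \<otimes> \<eta>) \<otimes> N) = \<iota> Y \<otimes> \<eta>"
    by (simp_all add: TransferL_sel)
  \<comment> \<open>The unit \<open>\<eta>\<close> slides past \<open>f\<close> and
    \<open>\<phi>\<close> until it meets \<open>m\<close>, where the right unit law cancels
    it.\<close>
  have absorb_right: "(\<iota> Y \<otimes> \<iota> Y \<otimes> m) \<cdot> (\<iota> Y \<otimes> \<phi> \<otimes> \<iota> A) \<cdot> (f \<otimes> \<iota> Y \<otimes> \<eta>) = (\<iota> Y \<otimes> \<phi>) \<cdot> (f \<otimes> \<iota> Y)"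
    if f: "f \<in> Ar C" "Cod C f = Y \<boxtimes> A" for f
  proof -
    note [simp] = f
    have "Dom C f \<in> Ob C" using Dom_in f by simp
    note [simp] = this
    have s1: "wh \<one> f (Y \<boxtimes> A) \<cdot> wh (Dom C f \<boxtimes> Y) \<eta> \<one> = wh (Y \<boxtimes> A \<boxtimes> Y) \<eta> \<one> \<cdot> wh \<one> f Y"
      using slide[of f \<eta> \<one> Y \<one>] by (simp add: diagram_simps)
    have s2: "wh Y \<phi> A \<cdot> wh (Y \<boxtimes> A \<boxtimes> Y) \<eta> \<one> = wh (Y \<boxtimes> Y \<boxtimes> A) \<eta> \<one> \<cdot> wh Y \<phi> \<one>"
      using slide[of \<phi> \<eta> Y \<one> \<one>] by (simp add: diagram_simps)
    have "(\<iota> Y \<otimes> \<iota> Y \<otimes> m) \<cdot> (\<iota> Y \<otimes> \<phi> \<otimes> \<iota> A) \<cdot> (f \<otimes> \<iota> Y \<otimes> \<eta>)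
        = wh (Y \<boxtimes> Y) m \<one> \<cdot> wh Y \<phi> A \<cdot> (wh (Y \<boxtimes> A \<boxtimes> Y) \<eta> \<one> \<cdot> wh \<one> f Y)"
      by (simp add: diagram_simps s1)
    also have "\<dots> = wh (Y \<boxtimes> Y) m \<one> \<cdot> (wh Y \<phi> A \<cdot> wh (Y \<boxtimes> A \<boxtimes> Y) \<eta> \<one>) \<cdot> wh \<one> f Y"
      by (simp add: diagram_simps)
    also have "\<dots> = wh Y (wh Y m \<one> \<cdot> wh (Y \<boxtimes> A) \<eta> \<one>) \<one> \<cdot> wh Y \<phi> \<one> \<cdot> wh \<one> f Y"
      unfolding s2 by (simp add: diagram_simps)
    finally show ?thesis unfolding u\<eta> by (simp add: diagram_simps)
  qed
  \<comment> \<open>Here \<open>\<eta>\<close> crosses \<open>Y\<close> by the unit axiom of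
    \<open>\<phi>\<close>, and the left unit law cancels it.\<close>
  have absorb_left: "(\<iota> Y \<otimes> \<iota> Y \<otimes> m) \<cdot> (\<iota> Y \<otimes> \<phi> \<otimes> \<iota> A) \<cdot> ((\<iota> Y \<otimes> \<eta>) \<otimes> f) = \<iota> Y \<otimes> f"
    if f: "f \<in> Ar C" "Cod C f = Y \<boxtimes> A" for f
  proof -
    note [simp] = f
    have "Dom C f \<in> Ob C" using Dom_in f by simp
    note [simp] = this
    have "(\<iota> Y \<otimes> \<iota> Y \<otimes> m) \<cdot> (\<iota> Y \<otimes> \<phi> \<otimes> \<iota> A) \<cdot> ((\<iota> Y \<otimes> \<eta>) \<otimes> f)
        = wh (Y \<boxtimes> Y) m \<one> \<cdot> wh Y (\<phi> \<cdot> wh \<one> \<eta> Y) A \<cdot> wh Y f \<one>"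
      by (simp add: diagram_simps)
    also have "\<dots> = wh (Y \<boxtimes> Y) (m \<cdot> (\<eta> \<otimes> \<iota> A)) \<one> \<cdot> wh Y f \<one>"
      unfolding \<phi>\<eta>' by (simp add: diagram_simps)
    finally show ?thesis unfolding mm by (simp add: diagram_simps)
  qed
  have MM: "(\<iota> Y \<otimes> m) \<cdot> (M \<otimes> \<iota> A) \<cdot> (\<iota> Y \<otimes> \<phi>) \<cdot> (M \<otimes> \<iota> Y) = (\<iota> Y \<otimes> m) \<cdot> (M \<otimes> \<iota> A) \<cdot> (\<iota> Y \<otimes> M)"
    and NM: "(\<iota> Y \<otimes> m) \<cdot> (M \<otimes> \<iota> A) \<cdot> (\<iota> Y \<otimes> \<phi>) \<cdot> (N \<otimes> \<iota> Y) = \<iota> Y \<otimes> \<eta>"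
    and MN: "(\<iota> Y \<otimes> m) \<cdot> (M \<otimes> \<iota> A) \<cdot> (\<iota> Y \<otimes> N) = \<iota> Y \<otimes> \<eta>"
    using T unfolding absorb_right[OF M(1,3)] absorb_right[OF N(1,3)] absorb_left[OF M(1,3)] absorb_left[OF N(1,3)]
    by simp_all
  have \<rho>\<rho>: "\<rho> \<cdot> (\<iota> Y \<otimes> \<rho>) = \<mu> \<cdot> (M \<otimes> \<iota> Y \<otimes> \<iota> A)"
  proof -
    have "\<rho> \<cdot> (\<iota> Y \<otimes> \<rho>) = (\<rho> \<cdot> (\<iota> Y \<otimes> \<iota> Y \<otimes> m)) \<cdot> wh Y M A"
      by (simp add: \<rho>_def diagram_simps)
    also have "\<dots> = (\<iota> Y \<otimes> m) \<cdot> wh \<one> ((\<iota> Y \<otimes> m) \<cdot> (M \<otimes> \<iota> A) \<cdot> (\<iota> Y \<otimes> M)) A"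
      unfolding \<rho>_lin by (simp add: \<rho>_def diagram_simps)
    also have "\<dots> = ((\<iota> Y \<otimes> m) \<cdot> (\<rho> \<otimes> \<iota> A)) \<cdot> wh Y \<phi> A \<cdot> wh \<one> M (Y \<boxtimes> A)"
      unfolding MM[symmetric] by (simp add: \<rho>_def diagram_simps)
    also have "\<dots> = \<mu> \<cdot> (M \<otimes> \<iota> Y \<otimes> \<iota> A)"
      unfolding \<rho>_lin[symmetric] by (simp add: \<mu>_def act_def diagram_simps)
    finally show ?thesis .
  qed
  \<comment> \<open>In the definition the last \<open>m\<close> acts after \<open>\<rho>\<close>.
    Linearity of \<open>\<rho>\<close> moves it in front, where it combines with
    \<open>\<phi>\<close> to \<open>act\<close>.\<close>
  have \<mu>: "wreath_product_mult C A m Y \<phi> M = \<mu>"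
  proof -
    have "wreath_product_mult C A m Y \<phi> M = ((\<iota> Y \<otimes> m) \<cdot> (\<rho> \<otimes> \<iota> A)) \<cdot> wh Y \<phi> A"
      by (simp add: wreath_product_mult_def \<rho>_def diagram_simps)
    then show ?thesis unfolding \<rho>_lin[symmetric] by (simp add: \<mu>_def act_def diagram_simps)
  qed
  have assoc: "\<mu> \<cdot> (\<mu> \<otimes> \<iota> (Y \<boxtimes> A)) = \<mu> \<cdot> (\<iota> (Y \<boxtimes> A) \<otimes> \<mu>)"
  proof -
    have s1: "wh \<one> \<phi> (Y \<boxtimes> A) \<cdot> wh (A \<boxtimes> Y) act \<one> = wh (Y \<boxtimes> A) act \<one> \<cdot> wh \<one> \<phi> (A \<boxtimes> Y \<boxtimes> A)"
      using slide[of \<phi> act \<one> \<one> \<one>] by (simp add: diagram_simps)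
    have s2: "wh \<one> M (Y \<boxtimes> A) \<cdot> wh (Y \<boxtimes> Y) act \<one> = wh (Y \<boxtimes> A) act \<one> \<cdot> wh \<one> M (A \<boxtimes> Y \<boxtimes> A)"
      using slide[of M act \<one> \<one> \<one>] by (simp add: diagram_simps)
    have "\<mu> \<cdot> (\<iota> (Y \<boxtimes> A) \<otimes> \<mu>) = \<rho> \<cdot> wh Y (act \<cdot> (\<iota> A \<otimes> \<rho>)) \<one> \<cdot> wh (Y \<boxtimes> A \<boxtimes> Y) act \<one>"
      by (simp add: \<mu>_def diagram_simps)
    also have "\<dots> = (\<rho> \<cdot> (\<iota> Y \<otimes> \<rho>)) \<cdot> wh (Y \<boxtimes> Y) act \<one> \<cdot> wh Y (wh \<one> \<phi> (Y \<boxtimes> A) \<cdot> wh (A \<boxtimes> Y) act \<one>) \<one>"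
      unfolding act\<rho> by (simp add: \<mu>_def diagram_simps)
    also have "\<dots> = (\<rho> \<cdot> (\<iota> Y \<otimes> \<rho>)) \<cdot> wh (Y \<boxtimes> Y) (act \<cdot> (\<iota> A \<otimes> act)) \<one> \<cdot> wh Y \<phi> (A \<boxtimes> Y \<boxtimes> A)"
      unfolding s1 by (simp add: diagram_simps)
    \<comment> \<open>Merging two actions by \<open>actact\<close> leaves an \<open>m\<close>
      directly after \<open>\<phi>\<close>; the two together form a new \<open>act\<close> on the
      first copies of \<open>Y\<close> and \<open>A\<close>.\<close>
    also have "\<dots> = \<mu> \<cdot> (wh \<one> M (Y \<boxtimes> A) \<cdot> wh (Y \<boxtimes> Y) act \<one>) \<cdot> wh Y act (Y \<boxtimes> A)"
      unfolding \<rho>\<rho> actact by (simp add: act_def diagram_simps)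
    also have "\<dots> = \<rho> \<cdot> wh Y (act \<cdot> (\<iota> A \<otimes> act)) \<one> \<cdot> wh \<one> M (A \<boxtimes> Y \<boxtimes> A) \<cdot> wh Y act (Y \<boxtimes> A)"
      unfolding s2 by (simp add: \<mu>_def diagram_simps)
    also have "\<dots> = \<mu> \<cdot> (\<mu> \<otimes> \<iota> (Y \<boxtimes> A))"
      unfolding actact by (simp add: \<mu>_def \<rho>_def diagram_simps)
    finally show ?thesis by simp
  qed
  have unitl: "\<mu> \<cdot> (N \<otimes> \<iota> (Y \<boxtimes> A)) = \<iota> (Y \<boxtimes> A)"
  proof -
    have "\<mu> \<cdot> (N \<otimes> \<iota> (Y \<boxtimes> A)) = (\<rho> \<cdot> (\<iota> Y \<otimes> \<iota> Y \<otimes> m)) \<cdot> wh Y \<phi> A \<cdot> wh \<one> N (Y \<boxtimes> A)"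
      by (simp add: \<mu>_def act_def diagram_simps)
    also have "\<dots> = (\<iota> Y \<otimes> m) \<cdot> wh \<one> ((\<iota> Y \<otimes> m) \<cdot> (M \<otimes> \<iota> A) \<cdot> (\<iota> Y \<otimes> \<phi>) \<cdot> (N \<otimes> \<iota> Y)) A"
      unfolding \<rho>_lin by (simp add: \<rho>_def diagram_simps)
    also have "\<dots> = wh Y (m \<cdot> (\<eta> \<otimes> \<iota> A)) \<one>"
      unfolding NM by (simp add: diagram_simps)
    finally show ?thesis unfolding mm by (simp add: diagram_simps)
  qed
  have unitr: "\<mu> \<cdot> (\<iota> (Y \<boxtimes> A) \<otimes> N) = \<iota> (Y \<boxtimes> A)"
  proof -
    have "\<mu> \<cdot> (\<iota> (Y \<boxtimes> A) \<otimes> N) = \<rho> \<cdot> wh Y ((\<iota> Y \<otimes> m) \<cdot> (\<phi> \<otimes> \<iota> A) \<cdot> (\<iota> A \<otimes> N)) \<one>"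
      by (simp add: \<mu>_def act_def diagram_simps)
    \<comment> \<open>The arrow condition for \<open>N\<close> moves it to the left of the strand
      \<open>A\<close>, next to \<open>Y\<close>, where \<open>MN\<close> applies.\<close>
    also have "\<dots> = (\<rho> \<cdot> (\<iota> Y \<otimes> \<iota> Y \<otimes> m)) \<cdot> wh Y N A"
      unfolding N\<phi>[symmetric] by (simp add: diagram_simps)
    also have "\<dots> = (\<iota> Y \<otimes> m) \<cdot> wh \<one> ((\<iota> Y \<otimes> m) \<cdot> (M \<otimes> \<iota> A) \<cdot> (\<iota> Y \<otimes> N)) A"
      unfolding \<rho>_lin by (simp add: \<rho>_def diagram_simps)
    also have "\<dots> = wh Y (m \<cdot> (\<eta> \<otimes> \<iota> A)) \<one>"
      unfolding MN by (simp add: diagram_simps)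
    finally show ?thesis unfolding mm by (simp add: diagram_simps)
  qed
  show ?thesis
    unfolding \<mu> algebra_in_def using assoc unitl unitr by (simp add: Hom_def typing_simps)
qed

text \<open>The map \<open>\<phi>\<close> slides past \<open>b\<close>, \<open>\<delta>\<close> and
  the inner \<open>d\<close> until it meets the outer \<open>d\<close>; there the mate equation
  replaces it by \<open>\<psi>\<close>.\<close>

lemma wreath_product_mult_mate:
  assumes adj: "adjunction_in C X Y b d" and \<psi>\<phi>: "mate X Y d X Y d A A \<psi> \<phi>"
    and \<delta>: "\<delta> \<in> Hom C X (A \<boxtimes> X \<boxtimes> X)"
  shows "wreath_product_mult C A m Y \<phi> ((\<iota> Y \<otimes> \<iota> A \<otimes> (d \<cdot> (\<iota> X \<otimes> d \<otimes> \<iota> Y)))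
      \<cdot> (\<iota> Y \<otimes> \<delta> \<otimes> \<iota> Y \<otimes> \<iota> Y) \<cdot> (b \<otimes> \<iota> Y \<otimes> \<iota> Y)) =
    (\<iota> Y \<otimes> m) \<cdot> (\<iota> Y \<otimes> m \<otimes> \<iota> A)
      \<cdot> (\<iota> Y \<otimes> \<iota> A \<otimes> \<iota> A \<otimes> d \<otimes> \<iota> A)
      \<cdot> (\<iota> Y \<otimes> \<iota> A \<otimes> \<psi> \<otimes> \<iota> Y \<otimes> \<iota> A)
      \<cdot> (\<iota> Y \<otimes> \<iota> A \<otimes> \<iota> X \<otimes> d \<otimes> \<iota> A \<otimes> \<iota> Y \<otimes> \<iota> A)
      \<cdot> (\<iota> Y \<otimes> \<delta> \<otimes> \<iota> Y \<otimes> \<iota> A \<otimes> \<iota> Y \<otimes> \<iota> A)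
      \<cdot> (b \<otimes> \<iota> Y \<otimes> \<iota> A \<otimes> \<iota> Y \<otimes> \<iota> A)"
proof -
  note [simp] = adjunctionD(1-8)[OF adj] mateD(1-6)[OF \<psi>\<phi>] HomD[OF \<delta>]
  have sb: "wh \<one> b (Y \<boxtimes> Y \<boxtimes> A \<boxtimes> A) \<cdot> wh Y \<phi> A = wh (Y \<boxtimes> X \<boxtimes> Y) \<phi> A \<cdot> wh \<one> b (Y \<boxtimes> A \<boxtimes> Y \<boxtimes> A)"
    using slide[of b \<phi> \<one> Y A] by (simp add: diagram_simps)
  have s\<delta>: "wh Y \<delta> (Y \<boxtimes> Y \<boxtimes> A \<boxtimes> A) \<cdot> wh (Y \<boxtimes> X \<boxtimes> Y) \<phi> A
      = wh (Y \<boxtimes> A \<boxtimes> X \<boxtimes> X \<boxtimes> Y) \<phi> A \<cdot> wh Y \<delta> (Y \<boxtimes> A \<boxtimes> Y \<boxtimes> A)"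
    using slide[of \<delta> \<phi> Y Y A] by (simp add: diagram_simps)
  have sd: "wh (Y \<boxtimes> A \<boxtimes> X) d (Y \<boxtimes> A \<boxtimes> A) \<cdot> wh (Y \<boxtimes> A \<boxtimes> X \<boxtimes> X \<boxtimes> Y) \<phi> A
      = wh (Y \<boxtimes> A \<boxtimes> X) \<phi> A \<cdot> wh (Y \<boxtimes> A \<boxtimes> X) d (A \<boxtimes> Y \<boxtimes> A)"
    using slide[of d \<phi> "Y \<boxtimes> A \<boxtimes> X" \<one> A] by (simp add: diagram_simps)
  have "wreath_product_mult C A m Y \<phi> ((\<iota> Y \<otimes> \<iota> A \<otimes> (d \<cdot> (\<iota> X \<otimes> d \<otimes> \<iota> Y)))
      \<cdot> (\<iota> Y \<otimes> \<delta> \<otimes> \<iota> Y \<otimes> \<iota> Y) \<cdot> (b \<otimes> \<iota> Y \<otimes> \<iota> Y)) =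
    wh Y m \<one> \<cdot> wh Y m A \<cdot> wh (Y \<boxtimes> A) d (A \<boxtimes> A) \<cdot> wh (Y \<boxtimes> A \<boxtimes> X) d (Y \<boxtimes> A \<boxtimes> A) \<cdot>
    wh Y \<delta> (Y \<boxtimes> Y \<boxtimes> A \<boxtimes> A) \<cdot> (wh \<one> b (Y \<boxtimes> Y \<boxtimes> A \<boxtimes> A) \<cdot> wh Y \<phi> A)"
    by (simp add: wreath_product_mult_def diagram_simps)
  also have "\<dots> = wh Y m \<one> \<cdot> wh Y m A \<cdot> wh (Y \<boxtimes> A) d (A \<boxtimes> A) \<cdot> wh (Y \<boxtimes> A \<boxtimes> X) d (Y \<boxtimes> A \<boxtimes> A) \<cdot>
    (wh Y \<delta> (Y \<boxtimes> Y \<boxtimes> A \<boxtimes> A) \<cdot> wh (Y \<boxtimes> X \<boxtimes> Y) \<phi> A) \<cdot> wh \<one> b (Y \<boxtimes> A \<boxtimes> Y \<boxtimes> A)"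
    unfolding sb by (simp add: diagram_simps)
  also have "\<dots> = wh Y m \<one> \<cdot> wh Y m A \<cdot> wh (Y \<boxtimes> A) d (A \<boxtimes> A) \<cdot>
    (wh (Y \<boxtimes> A \<boxtimes> X) d (Y \<boxtimes> A \<boxtimes> A) \<cdot> wh (Y \<boxtimes> A \<boxtimes> X \<boxtimes> X \<boxtimes> Y) \<phi> A) \<cdot>
    wh Y \<delta> (Y \<boxtimes> A \<boxtimes> Y \<boxtimes> A) \<cdot> wh \<one> b (Y \<boxtimes> A \<boxtimes> Y \<boxtimes> A)"
    unfolding s\<delta> by (simp add: diagram_simps)
  also have "\<dots> = wh Y m \<one> \<cdot> wh Y m A \<cdot> wh (Y \<boxtimes> A) ((d \<otimes> \<iota> A) \<cdot> (\<iota> X \<otimes> \<phi>)) A \<cdot>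
    wh (Y \<boxtimes> A \<boxtimes> X) d (A \<boxtimes> Y \<boxtimes> A) \<cdot> wh Y \<delta> (Y \<boxtimes> A \<boxtimes> Y \<boxtimes> A) \<cdot> wh \<one> b (Y \<boxtimes> A \<boxtimes> Y \<boxtimes> A)"
    unfolding sd by (simp add: diagram_simps)
  finally show ?thesis
    unfolding mateD(7)[OF \<psi>\<phi>] by (simp add: diagram_simps)
qed

end

section \<open>Identification of the structure maps as mates\<close>

theorem proposition3p3:
  fixes C :: "('o, 'm) monoidal_data" (structure)
    and A X Y :: 'o and m \<eta> b d \<psi> \<phi> :: 'm
  assumes "strict_monoidal_category C"
    and "algebra_in C A m \<eta>"
    and "adjunction_in C X Y b d"
    and "\<psi> \<in> Hom C (X \<boxtimes> A) (A \<boxtimes> X)"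
    and "\<phi> = (\<iota> Y \<otimes> \<iota> A \<otimes> d) \<cdot> (\<iota> Y \<otimes> \<psi> \<otimes> \<iota> Y) \<cdot> (b \<otimes> \<iota> A \<otimes> \<iota> Y)"
  shows
    "(\<forall>\<delta> \<epsilon>. cowreath C A m \<eta> X \<psi> \<delta> \<epsilon> \<longrightarrow>
       (let d2 = d \<cdot> (\<iota> X \<otimes> d \<otimes> \<iota> Y);
            m\<^sub>Y = (\<iota> Y \<otimes> \<iota> A \<otimes> d2) \<cdot> (\<iota> Y \<otimes> \<delta> \<otimes> \<iota> Y \<otimes> \<iota> Y) \<cdot> (b \<otimes> \<iota> Y \<otimes> \<iota> Y);
            \<eta>\<^sub>Y = (\<iota> Y \<otimes> \<epsilon>) \<cdot> b;
            m\<^sub>s = (\<iota> Y \<otimes> m) \<cdot> (\<iota> Y \<otimes> m \<otimes> \<iota> A)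
                 \<cdot> (\<iota> Y \<otimes> \<iota> A \<otimes> \<iota> A \<otimes> d \<otimes> \<iota> A)
                 \<cdot> (\<iota> Y \<otimes> \<iota> A \<otimes> \<psi> \<otimes> \<iota> Y \<otimes> \<iota> A)
                 \<cdot> (\<iota> Y \<otimes> \<iota> A \<otimes> \<iota> X \<otimes> d \<otimes> \<iota> A \<otimes> \<iota> Y \<otimes> \<iota> A)
                 \<cdot> (\<iota> Y \<otimes> \<delta> \<otimes> \<iota> Y \<otimes> \<iota> A \<otimes> \<iota> Y \<otimes> \<iota> A)
                 \<cdot> (b \<otimes> \<iota> Y \<otimes> \<iota> A \<otimes> \<iota> Y \<otimes> \<iota> A);
            \<eta>\<^sub>s = (\<iota> Y \<otimes> \<epsilon>) \<cdot> b
        in right_wreath C A m \<eta> Y \<phi> m\<^sub>Y \<eta>\<^sub>Y \<and>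
           wreath_product_mult C A m Y \<phi> m\<^sub>Y = m\<^sub>s \<and> \<eta>\<^sub>Y = \<eta>\<^sub>s \<and>
           algebra_in C (Y \<boxtimes> A) m\<^sub>s \<eta>\<^sub>s))
   \<and> (\<forall>m\<^sub>X \<eta>\<^sub>X. left_wreath C A m \<eta> X \<psi> m\<^sub>X \<eta>\<^sub>X \<longrightarrow>
       (let b2 = (\<iota> Y \<otimes> b \<otimes> \<iota> X) \<cdot> b;
            \<delta>' = (\<iota> Y \<otimes> \<iota> Y \<otimes> \<iota> A \<otimes> d) \<cdot> (\<iota> Y \<otimes> \<iota> Y \<otimes> m\<^sub>X \<otimes> \<iota> Y) \<cdot> (b2 \<otimes> \<iota> Y);
            \<epsilon>' = (\<iota> A \<otimes> d) \<cdot> (\<eta>\<^sub>X \<otimes> \<iota> Y)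
        in left_cowreath C A m \<eta> Y \<phi> \<delta>' \<epsilon>'))"
proof -
  interpret algebra_in_category C A m \<eta>
    using assms(1,2) by (simp add: algebra_in_category_def algebra_in_category_axioms_def)
  note adj = assms(3)
  note [simp] = adjunctionD(1-8)[OF adj] HomD[OF assms(4)]
  have dp: "dual_pair X Y d" using adj dual_pair_def by blast
  have \<psi>\<phi>: "mate X Y d X Y d A A \<psi> \<phi>"
    unfolding assms(5) by (rule mate_exists[OF adj dp _ _ assms(4)]) simp_all
  have ob: "mate_ob d (X, \<psi>) (Y, \<phi>)" using dp \<psi>\<phi> by (simp add: mate_ob_iff)
  let ?d2 = "d \<cdot> (\<iota> X \<otimes> d \<otimes> \<iota> Y)" let ?b2 = "(\<iota> Y \<otimes> b \<otimes> \<iota> X) \<cdot> b"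
  have d2: "?d2 = counit_comp X Y d d" by (simp add: counit_comp_def)
  \<comment> \<open>The multiplication and comultiplication on \<open>Y\<close> are mates over this
    adjunction and the given one.\<close>
  have adj2: "adjunction_in C (X \<boxtimes> X) (Y \<boxtimes> Y) ?b2 ?d2"
    unfolding d2 by (rule adjunction_comp[OF adj adj])
  have dp2: "dual_pair (X \<boxtimes> X) (Y \<boxtimes> Y) ?d2" using adj2 dual_pair_def by blast
  have dp0: "dual_pair \<one> \<one> (\<iota> \<one>)" using adjunction_Unit dual_pair_def by blast
  let ?xx = "TensorOb TR (X, \<psi>) (X, \<psi>)" let ?yy = "TensorOb TL (Y, \<phi>) (Y, \<phi>)"
  have ob2: "mate_ob ?d2 ?xx ?yy" unfolding d2 by (rule mate_ob_Tensor[OF ob ob])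
  show ?thesis
  proof (intro conjI allI impI)
    fix \<delta> \<epsilon> assume "cowreath C A m \<eta> X \<psi> \<delta> \<epsilon>"
    then have co: "coalgebra_in TR (X, \<psi>) ((X, \<psi>), \<delta>, ?xx) ((X, \<psi>), \<epsilon>, Unit TR)"
      by (simp add: cowreath_def Let_def)
    then have \<delta>: "\<delta> \<in> Hom C X (A \<boxtimes> X \<boxtimes> X)" and \<epsilon>: "\<epsilon> \<in> Hom C X (A \<boxtimes> \<one>)"
      by (auto simp: coalgebra_in_def Hom_def TransferR_Ar TransferR_sel)
    note [simp] = HomD[OF \<delta>] HomD[OF \<epsilon>]
    let ?M = "(\<iota> Y \<otimes> \<iota> A \<otimes> ?d2) \<cdot> (\<iota> Y \<otimes> \<delta> \<otimes> \<iota> Y \<otimes> \<iota> Y) \<cdot> (b \<otimes> \<iota> Y \<otimes> \<iota> Y)"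
    let ?N = "(\<iota> Y \<otimes> \<epsilon>) \<cdot> b"
    \<comment> \<open>The formula of \<open>mate_exists\<close> with \<open>U = \<one>\<close> and
      the composite adjunction as target becomes \<open>?M\<close>.\<close>
    have "mate X Y d (X \<boxtimes> X) (Y \<boxtimes> Y) ?d2 \<one> A \<delta> ?M"
      using mate_exists[OF adj dp2, of \<one> A \<delta>] \<delta>
      by (simp add: diagram_simps)
    then have M: "mate_ar d (counit_comp X Y d d) ((X, \<psi>), \<delta>, ?xx) (?yy, ?M, (Y, \<phi>))"
      using ob ob2 unfolding d2 by (simp add: mate_ar_iff TransferR_sel TransferL_sel)
    \<comment> \<open>The unit object is its own dual with identity counit, so only \<open>b\<close>
      and \<open>\<epsilon>\<close> survive in the formula.\<close>
    have "mate X Y d \<one> \<one> (\<iota> \<one>) \<one> A \<epsilon> ?N"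
      using mate_exists[OF adj dp0, of \<one> A \<epsilon>] \<epsilon> by (simp add: diagram_simps)
    then have N: "mate_ar d (\<iota> \<one>) ((X, \<psi>), \<epsilon>, Unit TR) (Unit TL, ?N, (Y, \<phi>))"
      using ob mate_ob_Unit by (simp add: mate_ar_iff TransferR_sel TransferL_sel)
    have rw: "right_wreath C A m \<eta> Y \<phi> ?M ?N"
      using dual_algebra[OF ob co M N] alg by (simp add: right_wreath_def Let_def TransferL_sel(1,2))
    show "let d2 = d \<cdot> (\<iota> X \<otimes> d \<otimes> \<iota> Y);
            m\<^sub>Y = (\<iota> Y \<otimes> \<iota> A \<otimes> d2) \<cdot> (\<iota> Y \<otimes> \<delta> \<otimes> \<iota> Y \<otimes> \<iota> Y) \<cdot> (b \<otimes> \<iota> Y \<otimes> \<iota> Y);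
            \<eta>\<^sub>Y = (\<iota> Y \<otimes> \<epsilon>) \<cdot> b;
            m\<^sub>s = (\<iota> Y \<otimes> m) \<cdot> (\<iota> Y \<otimes> m \<otimes> \<iota> A)
                 \<cdot> (\<iota> Y \<otimes> \<iota> A \<otimes> \<iota> A \<otimes> d \<otimes> \<iota> A)
                 \<cdot> (\<iota> Y \<otimes> \<iota> A \<otimes> \<psi> \<otimes> \<iota> Y \<otimes> \<iota> A)
                 \<cdot> (\<iota> Y \<otimes> \<iota> A \<otimes> \<iota> X \<otimes> d \<otimes> \<iota> A \<otimes> \<iota> Y \<otimes> \<iota> A)
                 \<cdot> (\<iota> Y \<otimes> \<delta> \<otimes> \<iota> Y \<otimes> \<iota> A \<otimes> \<iota> Y \<otimes> \<iota> A)
                 \<cdot> (b \<otimes> \<iota> Y \<otimes> \<iota> A \<otimes> \<iota> Y \<otimes> \<iota> A);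
            \<eta>\<^sub>s = (\<iota> Y \<otimes> \<epsilon>) \<cdot> b
        in right_wreath C A m \<eta> Y \<phi> m\<^sub>Y \<eta>\<^sub>Y \<and>
           wreath_product_mult C A m Y \<phi> m\<^sub>Y = m\<^sub>s \<and> \<eta>\<^sub>Y = \<eta>\<^sub>s \<and>
           algebra_in C (Y \<boxtimes> A) m\<^sub>s \<eta>\<^sub>s"
      using rw wreath_product_algebra[OF rw] unfolding Let_def wreath_product_mult_mate[OF adj \<psi>\<phi> \<delta>]
      by blast
  next
    fix m\<^sub>X \<eta>\<^sub>X assume "left_wreath C A m \<eta> X \<psi> m\<^sub>X \<eta>\<^sub>X"
    then have al: "algebra_in TR (X, \<psi>) (?xx, m\<^sub>X, (X, \<psi>)) (Unit TR, \<eta>\<^sub>X, (X, \<psi>))"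
      by (simp add: left_wreath_def Let_def)
    then have mX: "m\<^sub>X \<in> Hom C (X \<boxtimes> X) (A \<boxtimes> X)" and \<eta>X: "\<eta>\<^sub>X \<in> Hom C \<one> (A \<boxtimes> X)"
      by (auto simp: algebra_in_def Hom_def TransferR_Ar TransferR_sel)
    note [simp] = HomD[OF mX] HomD[OF \<eta>X]
    let ?D = "(\<iota> Y \<otimes> \<iota> Y \<otimes> \<iota> A \<otimes> d) \<cdot> (\<iota> Y \<otimes> \<iota> Y \<otimes> m\<^sub>X \<otimes> \<iota> Y) \<cdot> (?b2 \<otimes> \<iota> Y)"
    let ?E = "(\<iota> A \<otimes> d) \<cdot> (\<eta>\<^sub>X \<otimes> \<iota> Y)"
    \<comment> \<open>Now the composite adjunction is the source and contributes its unit
      \<open>?b2\<close>, while the target contributes a single \<open>d\<close>.\<close>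
    have "mate (X \<boxtimes> X) (Y \<boxtimes> Y) ?d2 X Y d \<one> A m\<^sub>X ?D"
      using mate_exists[OF adj2 dp, of \<one> A m\<^sub>X] mX by (simp add: diagram_simps)
    then have D: "mate_ar (counit_comp X Y d d) d (?xx, m\<^sub>X, (X, \<psi>)) ((Y, \<phi>), ?D, ?yy)"
      using ob ob2 unfolding d2 by (simp add: mate_ar_iff TransferR_sel TransferL_sel)
    \<comment> \<open>The source is the self-dual unit object, whose unit is an identity, so no
      \<open>b\<close> remains in \<open>?E\<close>.\<close>
    have "mate \<one> \<one> (\<iota> \<one>) X Y d \<one> A \<eta>\<^sub>X ?E"
      using mate_exists[OF adjunction_Unit dp, of \<one> A \<eta>\<^sub>X] \<eta>X by (simp add: diagram_simps)
    then have E: "mate_ar (\<iota> \<one>) d (Unit TR, \<eta>\<^sub>X, (X, \<psi>)) ((Y, \<phi>), ?E, Unit TL)"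
      using ob mate_ob_Unit by (simp add: mate_ar_iff TransferR_sel TransferL_sel)
    have "left_cowreath C A m \<eta> Y \<phi> ?D ?E"
      using dual_coalgebra[OF ob al D E] alg by (simp add: left_cowreath_def Let_def TransferL_sel(1,2))
    then show "let b2 = (\<iota> Y \<otimes> b \<otimes> \<iota> X) \<cdot> b;
            \<delta>' = (\<iota> Y \<otimes> \<iota> Y \<otimes> \<iota> A \<otimes> d) \<cdot> (\<iota> Y \<otimes> \<iota> Y \<otimes> m\<^sub>X \<otimes> \<iota> Y) \<cdot> (b2 \<otimes> \<iota> Y);
            \<epsilon>' = (\<iota> A \<otimes> d) \<cdot> (\<eta>\<^sub>X \<otimes> \<iota> Y)
        in left_cowreath C A m \<eta> Y \<phi> \<delta>' \<epsilon>'"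
      unfolding Let_def .
  qed
qed

end
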